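(* Let $G$ be a disk graph. Then $$\frac{\mathrm{Cap}(G)}{\mathrm{FCP}(G)}\le\frac32.$$
   Context: A disk graph is a finite simple undirected graph for which one can assign to each vertex a closed disk in the plane (of arbitrary positive radius, radii may differ) such that two distinct vertices are adjacent if and only if their disks intersect (overlapping or touching at a single point). Let $G$ have vertices $v_1,\dots,v_n$; $N(v_i)$ is the set of neighbors of $v_i$ (not containing $v_i$). Storage capacity: for a finite alphabet $\Sigma$ with $|\Sigma|=q\ge 2$, a nonempty set $\mathcal C\subseteq\Sigma^n$ is a recoverable distributed storage system code for $G$ if there are functions $g_i:\Sigma^{|N(v_i)|}\to\Sigma$ ($i=1,\dots,n$) such that for every $X=(X_1,\dots,X_n)\in\mathcal C$ and every $i$, $g_i((X_j)_{v_j\in N(v_i)})=X_i$. Put $\mathrm{Cap}_q(G)=\max_{\mathcal C}\log_q|\mathcal C|$ and $\mathrm{Cap}(G)=\sup_{q\ge 2}\mathrm{Cap}_q(G)$. Maximum fractional clique packing: let $\mathcal K$ be the set of all cliques (nonempty vertex sets inducing complete subgraphs, including single vertices) of $G$. $\mathrm{FCP}(G)$ is the maximum of $\sum_{C\in\mathcal K}x_C(|C|-1)$ subject to $\sum_{C\in\mathcal K: v\in C}x_C\le 1$ for all vertices $v$ and $0\le x_C\le 1$ for all $C\in\mathcal K$. *)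

theory Defs
  imports "HOL-Analysis.Analysis" "Graph_Theory.Pair_Digraph"
begin

text \<open>
  A finite simple undirected graph is a \<^locale>\<open>pair_graph\<close>: a finite symmetric loop-free relation
  \<^term>\<open>parcs G\<close> on a finite vertex set \<^term>\<open>pverts G\<close>.
\<close>

definition disk_graph :: "'a pair_pre_digraph \<Rightarrow> bool" where
  "disk_graph G \<longleftrightarrow> pair_graph G \<and>
     (\<exists>(c :: 'a \<Rightarrow> real ^ 2) (r :: 'a \<Rightarrow> real).
        (\<forall>v\<in>pverts G. 0 < r v) \<and>
        (\<forall>u\<in>pverts G. \<forall>v\<in>pverts G. u \<noteq> v \<longrightarrow>
           ((u, v) \<in> parcs G \<longleftrightarrow> cball (c u) (r u) \<inter> cball (c v) (r v) \<noteq> {})))"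

definition neighbours :: "'a pair_pre_digraph \<Rightarrow> 'a \<Rightarrow> 'a set" where
  "neighbours G v = {u \<in> pverts G. (v, u) \<in> parcs G}"


subsection \<open>Storage capacity\<close>

text \<open>
  Words over the alphabet \<open>A\<close> are indexed by the vertices, as extensional functions on
  \<^term>\<open>pverts G\<close>; the recovery function of \<open>v\<close> receives the restriction of the word to the
  neighbours of \<open>v\<close>.
\<close>

definition rdss_code :: "'a pair_pre_digraph \<Rightarrow> 'b set \<Rightarrow> ('a \<Rightarrow> 'b) set \<Rightarrow> bool" where
  "rdss_code G A \<C> \<longleftrightarrow>
     \<C> \<noteq> {} \<and> \<C> \<subseteq> (\<Pi>\<^sub>E v\<in>pverts G. A) \<and>
     (\<exists>g :: 'a \<Rightarrow> ('a \<Rightarrow> 'b) \<Rightarrow> 'b.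
        (\<forall>v\<in>pverts G. g v \<in> (\<Pi>\<^sub>E u\<in>neighbours G v. A) \<rightarrow> A) \<and>
        (\<forall>X\<in>\<C>. \<forall>v\<in>pverts G. g v (restrict X (neighbours G v)) = X v))"

text \<open>Only the size of the alphabet matters, so \<^term>\<open>{..<q}\<close> serves as the alphabet of size \<open>q\<close>.\<close>

definition capacity_q :: "nat \<Rightarrow> 'a pair_pre_digraph \<Rightarrow> real" where
  "capacity_q q G = Max ((\<lambda>\<C>. log (real q) (real (card \<C>))) ` {\<C>. rdss_code G {..<q} \<C>})"

definition capacity :: "'a pair_pre_digraph \<Rightarrow> real" where
  "capacity G = (SUP q\<in>{2..}. capacity_q q G)"


subsection \<open>Fractional clique packing\<close>

definition cliques :: "'a pair_pre_digraph \<Rightarrow> 'a set set" where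
  "cliques G = {C. C \<noteq> {} \<and> C \<subseteq> pverts G \<and> (\<forall>u\<in>C. \<forall>v\<in>C. u \<noteq> v \<longrightarrow> (u, v) \<in> parcs G)}"

definition frac_clique_packings :: "'a pair_pre_digraph \<Rightarrow> ('a set \<Rightarrow> real) set" where
  "frac_clique_packings G =
     {x. (\<forall>C\<in>cliques G. 0 \<le> x C \<and> x C \<le> 1) \<and>
         (\<forall>v\<in>pverts G. (\<Sum>C | C \<in> cliques G \<and> v \<in> C. x C) \<le> 1)}"

definition packing_value :: "'a pair_pre_digraph \<Rightarrow> ('a set \<Rightarrow> real) \<Rightarrow> real" where
  "packing_value G x = (\<Sum>C\<in>cliques G. x C * (real (card C) - 1))"

text \<open>The supremum is attained, see \<open>FCP_is_maximum\<close> below.\<close>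

definition FCP :: "'a pair_pre_digraph \<Rightarrow> real" where
  "FCP G = (SUP x\<in>frac_clique_packings G. packing_value G x)"


subsection \<open>The extrema are taken over sets on which they are meaningful\<close>

lemma finite_rdss_codes:
  assumes "finite (pverts G)" "finite A"
  shows "finite {\<C>. rdss_code G A \<C>}"
proof (rule finite_subset)
  show "{\<C>. rdss_code G A \<C>} \<subseteq> Pow (\<Pi>\<^sub>E v\<in>pverts G. A)"
    by (auto simp: rdss_code_def)
  show "finite (Pow (\<Pi>\<^sub>E v\<in>pverts G. A))"
    using assms by (simp add: finite_PiE)
qed

lemma rdss_code_singleton:
  assumes "a \<in> A"
  shows "rdss_code G A {\<lambda>v\<in>pverts G. a}"
  unfolding rdss_code_def using assms by (intro conjI exI[of _ "\<lambda>v X. a"]) auto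

lemma capacity_q_le_card:
  assumes "finite (pverts G)" "2 \<le> q"
  shows "capacity_q q G \<le> real (card (pverts G))"
  unfolding capacity_q_def
proof (rule Max.boundedI)
  show "finite ((\<lambda>\<C>. log (real q) (real (card \<C>))) ` {\<C>. rdss_code G {..<q} \<C>})"
    using assms by (simp add: finite_rdss_codes)
  show "(\<lambda>\<C>. log (real q) (real (card \<C>))) ` {\<C>. rdss_code G {..<q} \<C>} \<noteq> {}"
    using rdss_code_singleton[of 0 "{..<q}" G] assms by auto
  fix y assume "y \<in> (\<lambda>\<C>. log (real q) (real (card \<C>))) ` {\<C>. rdss_code G {..<q} \<C>}"
  then obtain \<C> where \<C>: "rdss_code G {..<q} \<C>" and y: "y = log (real q) (real (card \<C>))"
    by auto
  have fin: "finite (\<Pi>\<^sub>E v\<in>pverts G. {..<q})"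
    using assms by (simp add: finite_PiE)
  have sub: "\<C> \<subseteq> (\<Pi>\<^sub>E v\<in>pverts G. {..<q})" and ne: "\<C> \<noteq> {}"
    using \<C> by (auto simp: rdss_code_def)
  have "card \<C> \<le> q ^ card (pverts G)"
    using card_mono[OF fin sub] assms by (simp add: card_PiE)
  then have le: "real (card \<C>) \<le> real q ^ card (pverts G)"
    by (metis of_nat_le_iff of_nat_power)
  have "0 < card \<C>"
    using finite_subset[OF sub fin] ne by (simp add: card_gt_0_iff)
  then have "log (real q) (real (card \<C>)) \<le> log (real q) (real q ^ card (pverts G))"
    using le assms by (subst log_le_cancel_iff) auto
  then show "y \<le> real (card (pverts G))"
    using assms y by (simp add: log_nat_power)
qed

lemma bdd_above_capacity_q:
  assumes "finite (pverts G)"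
  shows "bdd_above ((\<lambda>q. capacity_q q G) ` {2..})"
  using capacity_q_le_card[OF assms] by (intro bdd_aboveI2) auto

lemma finite_cliques: "finite (pverts G) \<Longrightarrow> finite (cliques G)"
  by (rule finite_subset[of _ "Pow (pverts G)"]) (auto simp: cliques_def)

lemma FCP_is_maximum:
  assumes "finite (pverts G)"
  shows "\<exists>x\<in>frac_clique_packings G. packing_value G x = FCP G \<and>
           (\<forall>y\<in>frac_clique_packings G. packing_value G y \<le> FCP G)"
proof -
  define B :: "('a set \<Rightarrow> real) set" where
    "B = (\<Pi>\<^sub>E C\<in>UNIV. if C \<in> cliques G then {0..1} else {0})"
  define S where "S = B \<inter> (\<Inter>v\<in>pverts G. {x. (\<Sum>C | C \<in> cliques G \<and> v \<in> C. x C) \<le> 1})"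
  have "compact B"
    unfolding B_def compactin_euclidean_iff[symmetric] euclidean_product_topology[symmetric]
    by (subst compactin_PiE) auto
  moreover have "closed (\<Inter>v\<in>pverts G. {x::'a set \<Rightarrow> real. (\<Sum>C | C \<in> cliques G \<and> v \<in> C. x C) \<le> 1})"
    by (intro closed_INT ballI closed_Collect_le continuous_intros continuous_on_product_coordinates)
  ultimately have comp: "compact S"
    unfolding S_def by (rule compact_Int_closed)
  have S0: "(\<lambda>_. 0) \<in> S"
    by (auto simp: S_def B_def)
  have "continuous_on S (packing_value G)"
    unfolding packing_value_def
    by (intro continuous_intros continuous_on_product_coordinates
          continuous_on_subset[OF continuous_on_product_coordinates subset_UNIV])
  from continuous_attains_sup[OF comp _ this] S0 obtain x
    where x: "x \<in> S" "\<And>y. y \<in> S \<Longrightarrow> packing_value G y \<le> packing_value G x"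
    by blast
  have "x \<in> B"
    using x(1) by (simp add: S_def)
  then have "x C \<in> (if C \<in> cliques G then {0..1} else {0})" for C
    unfolding B_def by (rule PiE_mem) simp
  then have "0 \<le> x C \<and> x C \<le> 1" if "C \<in> cliques G" for C
    using that by (metis atLeastAtMost_iff)
  then have xF: "x \<in> frac_clique_packings G"
    using x(1) by (simp add: S_def frac_clique_packings_def)
  have le: "packing_value G y \<le> packing_value G x" if y: "y \<in> frac_clique_packings G" for y
  proof -
    define z where "z C = (if C \<in> cliques G then y C else 0)" for C
    have "(\<Sum>C | C \<in> cliques G \<and> v \<in> C. z C) = (\<Sum>C | C \<in> cliques G \<and> v \<in> C. y C)" for v
      by (rule sum.cong) (auto simp: z_def)
    then have "z \<in> S"
      using y by (auto simp: S_def B_def frac_clique_packings_def z_def)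
    moreover have "packing_value G z = packing_value G y"
      unfolding packing_value_def by (rule sum.cong) (auto simp: z_def)
    ultimately show ?thesis
      using x(2) by metis
  qed
  have "FCP G = packing_value G x"
    unfolding FCP_def by (rule cSup_eq_maximum) (use xF le in auto)
  then show ?thesis
    using xF le by metis
qed

end

theory Submission
  imports Defs
begin

text \<open>
  A code is determined by its restriction to a vertex cover, so the capacity is at most the size of
  any vertex cover, and it suffices to find a vertex cover \<open>C\<close> and a fractional clique packing of
  value at least \<open>2/3 * card C\<close>. A triangle is put into the cover entirely and contributes value
  \<open>2\<close> to the packing. Once no triangle is left, the segments joining the centres of adjacent disks
  do not cross, so by Euler's inequality some vertex has degree at most 3 and the graph is
  4-colourable. For a 4-colourable graph the half-integral matching of a crown decomposition is a
  packing of the required value. The Euler inequality \<open>E < V + F\<close> is proved by linear algebra over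
  GF(2): an even edge set is determined by the crossing parities of the faces.
\<close>

subsection \<open>Straight-line drawings\<close>

text \<open>Both parts of the cover meet the ratio 3/2 exactly: a triangle costs 3 and earns 2, and
  on vertices that earn 1/2 each, leaving out the largest of four colour classes costs at most 3/4
  per vertex. Five colours would cost up to 4/5, so degree at most 3 is what the colouring needs.
  This is why triangles are removed first: with triangular faces, Euler's inequality would only
  yield a vertex of degree at most 5. Faces as regions of the plane would require the Jordan curve
  theorem. They are replaced by classes of darts, and only one property of them is used: for an edge
  set with even degrees, the parity of the number of its edges overhead does not change along a face
  boundary.\<close>

lemma even_card_inter_family:
  fixes X :: "'i \<Rightarrow> 'b set"
  assumes "finite A" "finite I" "card I < card A"
  shows "\<exists>S\<subseteq>A. S \<noteq> {} \<and> (\<forall>i\<in>I. even (card (S \<inter> X i)))"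
proof -
  \<comment> \<open>\<open>F S\<close> is the set of equations violated by \<open>S\<close>. There
    are more subsets of \<open>A\<close> than such patterns, and two subsets with the same pattern
    have a symmetric difference that solves the homogeneous system over GF(2).\<close>
  define F where "F S = {i\<in>I. odd (card (S \<inter> X i))}" for S
  have "\<not> inj_on F (Pow A)"
  proof
    assume "inj_on F (Pow A)"
    then have "card (Pow A) \<le> card (Pow I)"
      by (rule card_inj_on_le) (use assms in \<open>auto simp: F_def\<close>)
    then show False
      using assms by (simp add: card_Pow)
  qed
  then obtain S1 S2 where S: "S1 \<subseteq> A" "S2 \<subseteq> A" "S1 \<noteq> S2" "F S1 = F S2"
    by (auto simp: inj_on_def)
  define S where "S = (S1 - S2) \<union> (S2 - S1)"
  have "even (card (S \<inter> X i))" if "i \<in> I" for i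
  proof -
    have fin: "finite (S1 \<inter> X i)" "finite (S2 \<inter> X i)"
      using S assms(1) by (auto dest: finite_subset)
    have "(S \<inter> X i) \<inter> S1 = (S1 \<inter> X i) - S2" "(S \<inter> X i) - S1 = (S2 \<inter> X i) - S1"
      "(S1 \<inter> X i) \<inter> S2 = (S2 \<inter> X i) \<inter> S1"
      by (auto simp: S_def)
    moreover have "finite (S \<inter> X i)"
      by (rule finite_subset[OF _ assms(1)]) (use S in \<open>auto simp: S_def\<close>)
    ultimately have "card (S \<inter> X i) + 2 * card ((S1 \<inter> X i) \<inter> S2) = card (S1 \<inter> X i) + card (S2 \<inter> X i)"
      using card_Int_Diff[OF fin(1), of S2] card_Int_Diff[OF fin(2), of S1] card_Int_Diff[of "S \<inter> X i" S1]
      by simp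
    moreover have "odd (card (S1 \<inter> X i)) \<longleftrightarrow> odd (card (S2 \<inter> X i))"
      using S(4) that unfolding F_def by blast
    ultimately show ?thesis by presburger
  qed
  moreover have "S \<subseteq> A" "S \<noteq> {}"
    using S by (auto simp: S_def)
  ultimately show ?thesis
    by blast
qed

section \<open>Drawings whose edges are graphs of affine functions\<close>

definition height :: "('a \<Rightarrow> real) \<Rightarrow> ('a \<Rightarrow> real) \<Rightarrow> 'a \<Rightarrow> 'a \<Rightarrow> real \<Rightarrow> real" where
  "height x y a b t = y a + (y b - y a) / (x b - x a) * (t - x a)"

text \<open>Distinct first coordinates exclude vertical edges, so incidence and crossing become
  comparisons of heights at a common abscissa. Besides crossings, \<open>noncrossing\<close> rules
  out overlapping edges and vertices with a neighbour lying inside a foreign edge; it says nothing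
  about isolated vertices.\<close>

locale plane_drawing =
  fixes V :: "'a set" and E :: "'a \<Rightarrow> 'a \<Rightarrow> bool" and x y :: "'a \<Rightarrow> real"
  assumes finite_V: "finite V"
    and E_sym: "E u v \<Longrightarrow> E v u"
    and E_irrefl: "\<not> E v v"
    and E_V: "E u v \<Longrightarrow> u \<in> V"
    and inj_x: "inj_on x V"
    and noncrossing: "\<lbrakk>E a b; E u v; {a, b} \<noteq> {u, v}; x a \<le> t; t \<le> x b; x u \<le> t; t \<le> x v;
          height x y a b t = height x y u v t\<rbrakk> \<Longrightarrow> \<exists>s\<in>{a, b} \<inter> {u, v}. x s = t"
begin

abbreviation h :: "'a \<Rightarrow> 'a \<Rightarrow> real \<Rightarrow> real" where "h \<equiv> height x y"

definition slope :: "'a \<Rightarrow> 'a \<Rightarrow> real" where "slope a b = (y b - y a) / (x b - x a)"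

lemma h_slope: "h a b t = y a + slope a b * (t - x a)"
  by (simp add: height_def slope_def)

lemma slope_commute: "slope a b = slope b a"
  unfolding slope_def by (metis minus_diff_eq minus_divide_divide)

lemma E_V2: "E u v \<Longrightarrow> v \<in> V"
  using E_V E_sym by blast

lemma E_x: "E u v \<Longrightarrow> x u \<noteq> x v"
  using E_V E_V2 E_irrefl inj_x by (metis inj_onD)

lemma h_ends: "x a \<noteq> x b \<Longrightarrow> h a b (x a) = y a" "x a \<noteq> x b \<Longrightarrow> h a b (x b) = y b"
  by (auto simp: height_def)

section \<open>Arcs, the rotation around a vertex and the two sides of a dart\<close>

definition arcs :: "('a \<times> 'a) set" where "arcs = {(a, b). E a b \<and> x a < x b}"

lemma finite_darts: "finite {(u, v). E u v}"
  by (rule finite_subset[of _ "V \<times> V"]) (use finite_V E_V E_V2 in auto)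

lemma finite_arcs: "finite arcs"
  by (rule finite_subset[OF _ finite_darts]) (auto simp: arcs_def)

lemma finite_nbrs: "finite {z. E v z}"
  by (rule finite_subset[OF _ finite_V]) (auto dest: E_V2)

definition edge :: "'a \<Rightarrow> 'a \<Rightarrow> 'a \<times> 'a" where
  "edge v z = (if x v < x z then (v, z) else (z, v))"

lemma inj_edge: "inj (edge v)"
  by (auto simp: inj_def edge_def split: if_splits)

lemma edge_arcs: "E v z \<Longrightarrow> edge v z \<in> arcs"
  using E_x[of v z] E_sym by (auto simp: edge_def arcs_def)

text \<open>
  Angle of the direction from \<open>v\<close> to \<open>z\<close>, up to a constant, measured counterclockwise starting from
  the upward vertical.
\<close>
definition key :: "'a \<Rightarrow> 'a \<Rightarrow> real" where
  "key v z = arctan (slope v z) + (if x v < x z then pi else 0)"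

definition above :: "'a \<Rightarrow> ('a \<times> 'a) set" where
  "above v = {(a, b) \<in> arcs. x a < x v \<and> x v < x b \<and> y v < h a b (x v)}"

text \<open>
  The arcs crossed on the way from the left (right) side of the dart from \<open>v\<close> to \<open>w\<close>, turning
  clockwise around \<open>v\<close> to the upward vertical and then following it to infinity.
\<close>
definition lside :: "'a \<Rightarrow> 'a \<Rightarrow> ('a \<times> 'a) set" where
  "lside v w = above v \<union> edge v ` {z. E v z \<and> key v z \<le> key v w}"

definition rside :: "'a \<Rightarrow> 'a \<Rightarrow> ('a \<times> 'a) set" where
  "rside v w = above v \<union> edge v ` {z. E v z \<and> key v z < key v w}"

text \<open>A change of order between \<open>t\<close> and \<open>s\<close> would produce, by the
  intermediate value theorem, a common point strictly inside both edges, where no end lies. The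
  point \<open>t\<close> may itself be an end, because the strict inequality there keeps the zero
  away from it.\<close>

lemma sign_const:
  assumes "E a b" "E u v" "{a, b} \<noteq> {u, v}"
    and t: "x a \<le> t" "t \<le> x b" "x u \<le> t" "t \<le> x v" "h u v t < h a b t"
    and s: "x a < s" "s < x b" "x u < s" "s < x v"
  shows "h u v s < h a b s"
proof (rule ccontr)
  assume neg: "\<not> ?thesis"
  define D where "D r = h a b r - h u v r" for r
  have cont: "continuous_on A D" for A
    unfolding D_def h_slope by (intro continuous_intros)
  have Ds: "D s \<le> 0" and Dt: "0 < D t"
    using neg t(5) by (auto simp: D_def)
  have "\<exists>r. D r = 0 \<and> x a < r \<and> r < x b \<and> x u < r \<and> r < x v"
  proof (cases "s \<le> t")
    case True
    then obtain r where r: "s \<le> r" "r \<le> t" "D r = 0"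
      using IVT'[of D s 0 t] Ds Dt cont by force
    then have "r \<noteq> t" using Dt by auto
    then show ?thesis using r s t by (intro exI[of _ r]) auto
  next
    case False
    then obtain r where r: "t \<le> r" "r \<le> s" "D r = 0"
      using IVT2'[of D s 0 t] Ds Dt cont by force
    then have "r \<noteq> t" using Dt by auto
    then show ?thesis using r s t by (intro exI[of _ r]) auto
  qed
  then obtain r where r: "D r = 0" "x a < r" "r < x b" "x u < r" "r < x v"
    by blast
  then have "\<exists>s\<in>{a, b} \<inter> {u, v}. x s = r"
    using assms by (intro noncrossing) (auto simp: D_def)
  then show False using r by auto
qed

text \<open>The edge from \<open>w\<close> to \<open>z\<close> turns the incidence into an equality
  of two heights at \<open>x w\<close>, to which \<open>noncrossing\<close> applies.\<close>

lemma not_on_edge: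
  assumes "E u v" "x u \<le> x w" "x w \<le> x v" "E w z" "w \<noteq> u" "w \<noteq> v"
  shows "h u v (x w) \<noteq> y w"
proof
  assume *: "h u v (x w) = y w"
  have wz: "x w \<noteq> x z" using E_x assms by blast
  have "\<exists>s\<in>{u,v} \<inter> {w,z}. x s = x w"
  proof (cases "x w < x z")
    case True
    then show ?thesis
      using assms wz * by (intro noncrossing) (auto simp: h_ends)
  next
    case False
    then have "\<exists>s\<in>{u,v} \<inter> {z,w}. x s = x w"
      using assms wz * E_sym by (intro noncrossing) (auto simp: h_ends)
    then show ?thesis by blast
  qed
  then show False
    using assms wz by (metis IntD1 IntD2 insertE singletonD)
qed

text \<open>Left neighbours have keys below \<open>pi / 2\<close> and right neighbours above it, so
  equal keys mean equal slopes on the same side of \<open>v\<close>. Then the nearer of the two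
  neighbours would lie on the edge to the farther one.\<close>

lemma key_inj:
  assumes "E v z" "E v w" "key v z = key v w"
  shows "z = w"
proof (rule ccontr)
  assume ne: "z \<noteq> w"
  have side: "x v < x z \<longleftrightarrow> x v < x w"
  proof (rule ccontr)
    assume "\<not> ?thesis"
    then show False
      using assms(3) arctan_bounded[of "slope v z"] arctan_bounded[of "slope v w"]
      by (auto simp: key_def split: if_splits)
  qed
  then have sl: "slope v z = slope v w"
    using assms(3) by (auto simp: key_def arctan_eq_iff split: if_splits)
  have xs: "x v \<noteq> x z" "x v \<noteq> x w" "x z \<noteq> x w"
    using assms E_x ne E_V2 inj_x by (auto dest: inj_onD)
  have "h v z (x w) = y w" "h v w (x z) = y z"
    using sl xs by (auto simp: h_slope slope_def field_simps)
  then have y: "h z v (x w) = y w" "h w v (x z) = y z" "h v z (x w) = y w" "h v w (x z) = y z"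
    using xs by (auto simp: height_def field_simps)
  have ww: "E w v" "E z v" "w \<noteq> v" "z \<noteq> v"
    using assms E_sym E_irrefl by auto
  show False
    using side xs y ww ne assms not_on_edge[of v z w v] not_on_edge[of v w z v]
      not_on_edge[of z v w v] not_on_edge[of w v z v]
    by (smt (verit))
qed

definition incident :: "'a \<Rightarrow> ('a \<times> 'a) set" where
  "incident v = {e\<in>arcs. fst e = v \<or> snd e = v}"

lemma incident_eq: "incident v = edge v ` {z. E v z}"
proof (intro set_eqI iffI)
  fix e assume e: "e \<in> incident v"
  then obtain a b where ab: "e = (a, b)" "E a b" "x a < x b" "a = v \<or> b = v"
    by (cases e) (auto simp: incident_def arcs_def)
  then show "e \<in> edge v ` {z. E v z}"
    by (auto simp: edge_def image_iff intro: E_sym)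
next
  fix e assume "e \<in> edge v ` {z. E v z}"
  then show "e \<in> incident v"
    by (auto simp: incident_def edge_arcs) (auto simp: edge_def split: if_splits)
qed

text \<open>
  Moving along the left side of an edge does not change the parity of the arcs of \<open>S\<close> overhead: the
  degrees in \<open>S\<close> of the vertices \<open>W\<close> in the vertical strip above the edge have an even sum, and this
  sum counts every arc in \<open>P\<close> twice, except for the ends leaving the strip on the left (\<open>Pu\<close>) or on the
  right (\<open>Pv\<close>).
\<close>
lemma transport_right:
  assumes S: "S \<subseteq> arcs" and ev: "\<And>v. v \<in> V \<Longrightarrow> even (card (S \<inter> incident v))"
    and uv: "E u v" "x u < x v"
  shows "even (card (S \<inter> lside u v)) \<longleftrightarrow> even (card (S \<inter> rside v u))"
proof -
  have finS: "finite S" using S finite_arcs finite_subset by blast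
  \<comment> \<open>The order is required on the whole open common interval: \<open>overI\<close>
    derives it from one point of the closed interval, and \<open>over_end\<close> extends it to the
    ends of that interval unless the edges meet there.\<close>
  define over where "over a b \<longleftrightarrow> (\<forall>s. x a < s \<longrightarrow> s < x b \<longrightarrow> x u < s \<longrightarrow> s < x v \<longrightarrow> h u v s < h a b s)" for a b
  define P where "P = {(a, b) \<in> S. (a, b) \<noteq> (u, v) \<and> x a < x v \<and> x u < x b \<and> over a b}"
  define Pu where "Pu = {(a, b) \<in> S. (x a < x u \<and> x u < x b \<and> y u < h a b (x u)) \<or> (a = u \<and> slope u v < slope u b)}"
  define Pv where "Pv = {(a, b) \<in> S. (x a < x v \<and> x v < x b \<and> y v < h a b (x v)) \<or> (b = v \<and> slope a v < slope u v)}"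
  define W where "W = {w\<in>V. x u < x w \<and> x w < x v \<and> h u v (x w) < y w}"
  have SD: "E a b" "x a < x b" "a \<in> V" "b \<in> V" if "(a, b) \<in> S" for a b
    using that S E_V E_V2 by (auto simp: arcs_def)
  have ne: "{a, b} \<noteq> {u, v}" if "(a, b) \<in> S" "(a, b) \<noteq> (u, v)" for a b
    using SD[OF that(1)] that(2) uv by (auto simp: doubleton_eq_iff)
  have overI: "over a b" if "(a, b) \<in> S" "(a, b) \<noteq> (u, v)"
      "x a \<le> t" "t \<le> x b" "x u \<le> t" "t \<le> x v" "h u v t < h a b t" for a b t
    unfolding over_def using sign_const[OF SD(1)[OF that(1)] uv(1) ne[OF that(1,2)] that(3-7)] by blast
  have over_end: "h u v t < h a b t" if ab: "(a, b) \<in> S" "(a, b) \<noteq> (u, v)" "x a < x v" "x u < x b" "over a b"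
      and t: "x a \<le> t" "t \<le> x b" "x u \<le> t" "t \<le> x v" and nz: "h a b t \<noteq> h u v t" for a b t
  proof (rule ccontr)
    assume "\<not> ?thesis"
    then have lt: "h a b t < h u v t" using nz by auto
    \<comment> \<open>The midpoint of the common interval, to which \<open>sign_const\<close>, with
      the two edges exchanged, carries the reversed order.\<close>
    define s where "s = (max (x a) (x u) + min (x b) (x v)) / 2"
    have s: "x a < s" "s < x b" "x u < s" "s < x v"
      unfolding s_def using ab uv SD(2)[OF ab(1)] by (auto simp: max_def min_def)
    have "h a b s < h u v s"
      by (rule sign_const[OF uv(1) SD(1)[OF ab(1)] ne[OF ab(1,2), symmetric] t(3,4,1,2) lt s(3,4,1,2)])
    then show False using ab(5) s unfolding over_def by fastforce
  qed
  have fin: "finite P" "finite Pu" "finite Pv"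
    by (rule finite_subset[OF _ finS]; force simp: P_def Pu_def Pv_def)+
  have PuP: "Pu \<subseteq> P"
  proof
    fix e assume e: "e \<in> Pu"
    obtain a b where [simp]: "e = (a, b)" by (cases e)
    have ab: "(a, b) \<in> S" using e by (auto simp: Pu_def)
    note SDab = SD[OF ab]
    consider "x a < x u" "x u < x b" "y u < h a b (x u)" | "a = u" "slope u v < slope u b"
      using e by (auto simp: Pu_def)
    then show "e \<in> P"
    proof cases
      case 1
      have "over a b"
        by (rule overI[OF ab, of "x u"]) (use 1 uv in \<open>auto simp: h_ends\<close>)
      then show ?thesis using 1 ab uv by (auto simp: P_def)
    next
      case 2
      \<comment> \<open>The edges agree at their common end \<open>u\<close>, so they are compared
        at the right end of the common interval instead.\<close>
      define t where "t = min (x b) (x v)"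
      have t: "x u < t" "t \<le> x b" "t \<le> x v" using 2 SDab uv by (auto simp: t_def)
      have "over a b"
        by (rule overI[OF ab, of t]) (use 2 t uv SDab in \<open>auto simp: h_slope\<close>)
      then show ?thesis using 2 ab uv SDab by (auto simp: P_def)
    qed
  qed
  have PvP: "Pv \<subseteq> P"
  proof
    fix e assume e: "e \<in> Pv"
    obtain a b where [simp]: "e = (a, b)" by (cases e)
    have ab: "(a, b) \<in> S" using e by (auto simp: Pv_def)
    note SDab = SD[OF ab]
    consider "x a < x v" "x v < x b" "y v < h a b (x v)" | "b = v" "slope a v < slope u v"
      using e by (auto simp: Pv_def)
    then show "e \<in> P"
    proof cases
      case 1
      have "over a b"
        by (rule overI[OF ab, of "x v"]) (use 1 uv in \<open>auto simp: h_ends\<close>)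
      then show ?thesis using 1 ab uv by (auto simp: P_def)
    next
      case 2
      define t where "t = max (x a) (x u)"
      have t: "t < x v" "x a \<le> t" "x u \<le> t" using 2 SDab uv by (auto simp: t_def)
      have hv: "h p v t = y v - slope p v * (x v - t)" if "x p < x v" for p
        using that by (simp add: height_def slope_def field_simps)
      have "slope a v * (x v - t) < slope u v * (x v - t)"
        using 2 t by (intro mult_strict_right_mono) auto
      then have "over a b"
        by (intro overI[OF ab, of t]) (use 2 t uv SDab in \<open>auto simp: hv\<close>)
      then show ?thesis using 2 ab uv SDab by (auto simp: P_def)
    qed
  qed
  have not_on: "h u v (x w) \<noteq> y w" if "E w z" "x u < x w" "x w < x v" for w z
    using not_on_edge[OF uv(1) _ _ that(1)] that by auto
  \<comment> \<open>An arc over the edge whose left end is not in \<open>W\<close> either enters the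
    strip through its left boundary or starts in \<open>u\<close>; these are the arcs in
    \<open>Pu\<close>. The mirror image relates right ends to \<open>Pv\<close>.\<close>
  have fstW: "{e\<in>S. fst e \<in> W} = P - Pu"
  proof (intro set_eqI iffI)
    fix e assume e: "e \<in> {e\<in>S. fst e \<in> W}"
    obtain a b where [simp]: "e = (a, b)" by (cases e)
    have ab: "(a, b) \<in> S" "x u < x a" "x a < x v" "h u v (x a) < y a" using e by (auto simp: W_def)
    have "over a b"
      by (rule overI[OF ab(1), of "x a"]) (use ab SD[OF ab(1)] in \<open>auto simp: h_ends\<close>)
    then show "e \<in> P - Pu"
      using ab SD[OF ab(1)] uv by (auto simp: P_def Pu_def)
  next
    fix e assume e: "e \<in> P - Pu"
    obtain a b where [simp]: "e = (a, b)" by (cases e)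
    have ab: "(a, b) \<in> S" "(a, b) \<noteq> (u, v)" "x a < x v" "x u < x b" "over a b" "(a, b) \<notin> Pu"
      using e by (auto simp: P_def)
    note SDab = SD[OF ab(1)]
    consider "x a < x u" | "a = u" | "x u < x a"
      using SDab(3) E_V[OF uv(1)] inj_x by (metis inj_onD linorder_less_linear)
    then have "a \<in> W"
    proof cases
      case 1
      have "h a b (x u) \<noteq> y u"
        by (rule not_on_edge[OF SDab(1) _ _ uv(1)]) (use 1 ab in auto)
      then have "h u v (x u) < h a b (x u)"
        using 1 ab SDab uv by (intro over_end[OF ab(1-5)]) (auto simp: h_ends)
      then show ?thesis
        using ab 1 uv by (auto simp: Pu_def h_ends)
    next
      case 2
      define t where "t = min (x b) (x v)"
      have t: "x u < t" "t \<le> x b" "t \<le> x v" using 2 SDab uv by (auto simp: t_def)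
      have "b \<noteq> v" using ab 2 by auto
      then have "key u b \<noteq> key u v"
        using key_inj[of u b v] SDab uv 2 by auto
      then have "slope u b \<noteq> slope u v"
        using 2 SDab uv by (auto simp: key_def)
      then have "h u v t < h a b t"
        using 2 t by (intro over_end[OF ab(1-5)]) (auto simp: h_slope)
      then have "slope u v < slope u b"
        using 2 t by (auto simp: h_slope)
      then show ?thesis
        using ab 2 by (auto simp: Pu_def)
    next
      case 3
      have "h u v (x a) \<noteq> y a"
        using not_on[OF SDab(1)] 3 ab by auto
      then have "h u v (x a) < h a b (x a)"
        using 3 ab SDab uv by (intro over_end[OF ab(1-5)]) (auto simp: h_ends)
      then show ?thesis
        using 3 ab SDab by (auto simp: W_def h_ends)
    qed
    then show "e \<in> {e\<in>S. fst e \<in> W}" using ab by auto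
  qed
  have sndW: "{e\<in>S. snd e \<in> W} = P - Pv"
  proof (intro set_eqI iffI)
    fix e assume e: "e \<in> {e\<in>S. snd e \<in> W}"
    obtain a b where [simp]: "e = (a, b)" by (cases e)
    have ab: "(a, b) \<in> S" "x u < x b" "x b < x v" "h u v (x b) < y b" using e by (auto simp: W_def)
    have "over a b"
      by (rule overI[OF ab(1), of "x b"]) (use ab SD[OF ab(1)] in \<open>auto simp: h_ends\<close>)
    then show "e \<in> P - Pv"
      using ab SD[OF ab(1)] uv by (auto simp: P_def Pv_def)
  next
    fix e assume e: "e \<in> P - Pv"
    obtain a b where [simp]: "e = (a, b)" by (cases e)
    have ab: "(a, b) \<in> S" "(a, b) \<noteq> (u, v)" "x a < x v" "x u < x b" "over a b" "(a, b) \<notin> Pv"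
      using e by (auto simp: P_def)
    note SDab = SD[OF ab(1)]
    consider "x v < x b" | "b = v" | "x b < x v"
      using SDab(4) E_V2[OF uv(1)] inj_x by (metis inj_onD linorder_less_linear)
    then have "b \<in> W"
    proof cases
      case 1
      have "h a b (x v) \<noteq> y v"
        by (rule not_on_edge[OF SDab(1) _ _ E_sym[OF uv(1)]]) (use 1 ab in auto)
      then have "h u v (x v) < h a b (x v)"
        using 1 ab SDab uv by (intro over_end[OF ab(1-5)]) (auto simp: h_ends)
      then show ?thesis
        using ab 1 uv by (auto simp: Pv_def h_ends)
    next
      case 2
      define t where "t = max (x a) (x u)"
      have t: "t < x v" "x a \<le> t" "x u \<le> t" using 2 SDab uv by (auto simp: t_def)
      have hv: "h p v t = y v - slope p v * (x v - t)" if "x p < x v" for p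
        using that by (simp add: height_def slope_def field_simps)
      have "a \<noteq> u" using ab 2 by auto
      then have "key v a \<noteq> key v u"
        using key_inj[of v a u] SDab uv 2 E_sym by auto
      then have sl: "slope a v \<noteq> slope u v"
        using 2 SDab uv by (auto simp: key_def slope_commute)
      have "h u v t < h a b t"
        using 2 t sl ab uv by (intro over_end[OF ab(1-5)]) (auto simp: hv)
      then have "slope a v < slope u v"
        using 2 t ab uv by (auto simp: hv)
      then show ?thesis
        using ab 2 by (auto simp: Pv_def)
    next
      case 3
      have "h u v (x b) \<noteq> y b"
        using not_on[OF E_sym[OF SDab(1)]] 3 ab by auto
      then have "h u v (x b) < h a b (x b)"
        using 3 ab SDab uv by (intro over_end[OF ab(1-5)]) (auto simp: h_ends)
      then show ?thesis
        using 3 ab SDab by (auto simp: W_def h_ends)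
    qed
    then show "e \<in> {e\<in>S. snd e \<in> W}" using ab by auto
  qed
  have fibre: "card {e\<in>S. f e \<in> W} = (\<Sum>w\<in>W. card {e\<in>S. f e = w})" for f :: "'a \<times> 'a \<Rightarrow> 'a"
  proof -
    have "{e\<in>S. f e \<in> W} = (\<Union>w\<in>W. {e\<in>S. f e = w})" by auto
    also have "card \<dots> = (\<Sum>w\<in>W. card {e\<in>S. f e = w})"
      by (rule card_UN_disjoint) (use finite_V finS in \<open>auto simp: W_def\<close>)
    finally show ?thesis .
  qed
  have inc: "card {e\<in>S. fst e = w} + card {e\<in>S. snd e = w} = card (S \<inter> incident w)" for w
    by (subst card_Un_disjoint[symmetric])
      (use finS S E_irrefl in \<open>auto simp: incident_def arcs_def intro!: arg_cong[of _ _ card]\<close>)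
  have "even (\<Sum>w\<in>W. card (S \<inter> incident w))"
    by (rule dvd_sum) (use ev in \<open>auto simp: W_def\<close>)
  then have "even (card (P - Pu) + card (P - Pv))"
    unfolding fstW[symmetric] sndW[symmetric] fibre sum.distrib[symmetric] inc .
  then have PP: "even (card Pu) \<longleftrightarrow> even (card Pv)"
    using card_Diff_subset[OF fin(2) PuP] card_Diff_subset[OF fin(3) PvP]
      card_mono[OF fin(1) PuP] card_mono[OF fin(1) PvP] by (auto simp: algebra_simps)
  have "S \<inter> rside v u = Pv"
  proof -
    have "key v z < key v u \<longleftrightarrow> x z < x v \<and> slope z v < slope u v" if "E v z" for z
      using uv arctan_bounded[of "slope v z"] arctan_bounded[of "slope v u"] E_x[OF that]
      by (auto simp: key_def slope_commute arctan_less_iff)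
    then have "edge v ` {z. E v z \<and> key v z < key v u} = {(a, b) \<in> arcs. b = v \<and> slope a v < slope u v}"
      by (force simp: edge_def arcs_def image_iff intro: E_sym)
    then show ?thesis
      using S unfolding rside_def Pv_def above_def by auto
  qed
  \<comment> \<open>The clockwise turn from the upper side of the edge to the vertical passes all
    arcs at \<open>u\<close> except those above the edge on the right. As \<open>u\<close> has even
    degree in \<open>S\<close>, these exceptions, \<open>C\<close>, may be counted instead of
    \<open>B\<close>.\<close>
  moreover have "even (card (S \<inter> lside u v)) \<longleftrightarrow> even (card Pu)"
  proof -
    have k: "key u z \<le> key u v \<longleftrightarrow> \<not> (x u < x z \<and> slope u v < slope u z)" if "E u z" for z
      using uv arctan_bounded[of "slope u z"] arctan_bounded[of "slope u v"] E_x[OF that]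
      by (auto simp: key_def arctan_le_iff not_less)
    define A where "A = S \<inter> above u"
    define B where "B = S \<inter> edge u ` {z. E u z \<and> key u z \<le> key u v}"
    define C where "C = S \<inter> edge u ` {z. E u z \<and> \<not> key u z \<le> key u v}"
    have fABC: "finite A" "finite B" "finite C" using finS by (auto simp: A_def B_def C_def)
    have AB: "A \<inter> B = {}" "A \<inter> C = {}"
      by (auto simp: A_def B_def C_def above_def edge_def)
    have BC: "B \<inter> C = {}"
      by (auto simp: B_def C_def dest: injD[OF inj_edge])
    have "S \<inter> incident u = B \<union> C"
      unfolding incident_eq B_def C_def by auto
    then have "even (card B + card C)"
      using ev[OF E_V[OF uv(1)]] card_Un_disjoint[OF fABC(2,3) BC] by simp
    moreover have "card (S \<inter> lside u v) = card A + card B"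
      using card_Un_disjoint[OF fABC(1,2) AB(1)] unfolding lside_def A_def B_def by (simp add: Int_Un_distrib)
    moreover have "Pu = A \<union> C"
    proof -
      have "C = {(a, b)\<in>S. a = u \<and> slope u v < slope u b}"
      proof (intro set_eqI iffI)
        fix e assume "e \<in> C"
        then obtain z where z: "E u z" "\<not> key u z \<le> key u v" "e = edge u z" "e \<in> S"
          by (auto simp: C_def)
        then show "e \<in> {(a, b)\<in>S. a = u \<and> slope u v < slope u b}"
          using k[OF z(1)] by (auto simp: edge_def)
      next
        fix e assume "e \<in> {(a, b)\<in>S. a = u \<and> slope u v < slope u b}"
        then obtain b where b: "e = (u, b)" "(u, b) \<in> S" "slope u v < slope u b"
          by auto
        have "E u b" "x u < x b" using b S by (auto simp: arcs_def)
        then show "e \<in> C"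
          using k[of b] b by (auto simp: C_def edge_def image_iff)
      qed
      then show ?thesis
        using S unfolding A_def Pu_def above_def by auto
    qed
    then have "card Pu = card A + card C"
      using card_Un_disjoint[OF fABC(1,3) AB(2)] by simp
    ultimately show ?thesis by presburger
  qed
  ultimately show ?thesis using PP by simp
qed

text \<open>Turning past the dart collects its own arc and, by \<open>key_inj\<close>, no other.
  This is the parity change that later contradicts constancy on faces.\<close>

lemma card_lside:
  assumes "S \<subseteq> arcs" "E v w"
  shows "card (S \<inter> lside v w) = card (S \<inter> rside v w) + (if edge v w \<in> S then 1 else 0)"
proof -
  have "{z. E v z \<and> key v z \<le> key v w} = insert w {z. E v z \<and> key v z < key v w}"
    using assms(2) key_inj[OF _ assms(2)] by (auto simp: order_le_less)
  then have "lside v w = insert (edge v w) (rside v w)"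
    unfolding lside_def rside_def by simp
  moreover have "edge v w \<notin> rside v w"
    by (auto simp: rside_def dest: injD[OF inj_edge]) (auto simp: above_def edge_def split: if_splits)
  moreover have "finite (S \<inter> rside v w)"
    using assms(1) finite_arcs finite_subset by blast
  ultimately show ?thesis by (cases "edge v w \<in> S") simp_all
qed

section \<open>Following a face along its darts\<close>

lemma edge_commute: "E u v \<Longrightarrow> edge u v = edge v u"
  using E_x[of u v] by (auto simp: edge_def)

text \<open>For an edge running leftwards, \<open>transport_right\<close> for the reversed dart
  compares the other two sides; by \<open>card_lside\<close> passing to the wanted sides changes
  both counts by the same arc.\<close>

lemma transport:
  assumes S: "S \<subseteq> arcs" and ev: "\<And>v. v \<in> V \<Longrightarrow> even (card (S \<inter> incident v))"
    and uv: "E u v"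
  shows "even (card (S \<inter> lside u v)) \<longleftrightarrow> even (card (S \<inter> rside v u))"
proof (cases "x u < x v")
  case True
  then show ?thesis using transport_right[OF S ev uv] by simp
next
  case False
  then have "x v < x u" using E_x[OF uv] by auto
  then have "even (card (S \<inter> lside v u)) \<longleftrightarrow> even (card (S \<inter> rside u v))"
    using transport_right[OF S ev E_sym[OF uv]] by simp
  then show ?thesis
    using card_lside[OF S uv] card_lside[OF S E_sym[OF uv]] edge_commute[OF uv] by (auto split: if_splits)
qed

text \<open>The cycle space of the graph over GF(2).\<close>

definition even_subgraph :: "('a \<times> 'a) set \<Rightarrow> bool" where
  "even_subgraph S \<longleftrightarrow> S \<subseteq> arcs \<and> (\<forall>v\<in>V. even (card (S \<inter> incident v)))"

text \<open>One step of the facial walk with the face on the left: \<open>w\<close> is the next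
  neighbour clockwise from \<open>u\<close> around \<open>v\<close>, so the right side of the dart
  back to \<open>u\<close> is the left side of the dart to \<open>w\<close>. If no key is smaller
  than that of \<open>u\<close>, the sector contains the upward vertical and \<open>w\<close> has
  the largest key; the two counts then differ by the degree of \<open>v\<close> in \<open>S\<close>,
  which is even. Degree at least 2 prevents turning back.\<close>

lemma next_dart:
  assumes uv: "E u v" and deg: "card {z. E v z} \<ge> 2"
  shows "\<exists>w. E v w \<and> w \<noteq> u \<and>
    (\<forall>S. even_subgraph S \<longrightarrow> (even (card (S \<inter> lside u v)) \<longleftrightarrow> even (card (S \<inter> lside v w))))"
proof -
  define A where "A = {z. E v z \<and> key v z < key v u}"
  have finA: "finite A" by (rule finite_subset[OF _ finite_nbrs[of v]]) (auto simp: A_def)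
  have vu: "E v u" using uv E_sym by blast
  have vV: "v \<in> V" using uv E_V2 by blast
  show ?thesis
  proof (cases "A = {}")
    case False
    then obtain w where w: "w \<in> A" "Max (key v ` A) = key v w"
      using obtains_MAX[OF finA] by metis
    then have "key v z \<le> key v w" if "z \<in> A" for z
      using Max_ge[of "key v ` A" "key v z"] finA that by auto
    then have "{z. E v z \<and> key v z \<le> key v w} = {z. E v z \<and> key v z < key v u}"
      using w(1) by (force simp: A_def)
    then have "lside v w = rside v u"
      unfolding lside_def rside_def by simp
    then show ?thesis
      using w transport[OF _ _ uv] by (intro exI[of _ w]) (auto simp: A_def even_subgraph_def)
  next
    case True
    obtain w where Ew: "E v w" and Mw: "Max (key v ` {z. E v z}) = key v w"
      using obtains_MAX[OF finite_nbrs[of v], of "key v"] vu by blast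
    have w: "E v w" "\<And>z. E v z \<Longrightarrow> key v z \<le> key v w"
      using Ew Mw Max_ge[of "key v ` {z. E v z}"] finite_nbrs by auto
    have "w \<noteq> u"
    proof
      assume "w = u"
      then have "z = u" if "E v z" for z
        using key_inj[OF that vu] w(2)[OF that] True that by (force simp: A_def)
      then have "{z. E v z} \<subseteq> {u}" by auto
      then have "card {z. E v z} \<le> 1" using card_mono[of "{u}"] by force
      then show False using deg by simp
    qed
    moreover have "even (card (S \<inter> lside u v)) \<longleftrightarrow> even (card (S \<inter> lside v w))"
      if "even_subgraph S" for S
    proof -
      have S: "S \<subseteq> arcs" "\<forall>v\<in>V. even (card (S \<inter> incident v))"
        using that by (auto simp: even_subgraph_def)
      have r: "rside v u = above v"
        using True by (auto simp: rside_def A_def)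
      have l: "lside v w = above v \<union> incident v"
        using w(2) unfolding incident_eq lside_def by auto
      have fin: "finite (S \<inter> above v)" "finite (S \<inter> incident v)"
        using S finite_arcs finite_subset by blast+
      have "(S \<inter> above v) \<inter> (S \<inter> incident v) = {}"
        by (auto simp: above_def incident_def)
      then have "card (S \<inter> lside v w) = card (S \<inter> rside v u) + card (S \<inter> incident v)"
        using card_Un_disjoint[OF fin] unfolding l r by (simp add: Int_Un_distrib)
      then show ?thesis
        using S(2) vV transport[OF S(1) _ uv] by auto
    qed
    ultimately show ?thesis using w(1) by blast
  qed
qed

section \<open>Counting darts, faces and arcs\<close>

lemma card_darts: "card {(u, v). E u v} = 2 * card arcs"
proof -
  have "{(u, v). E u v} = arcs \<union> prod.swap ` arcs"
    using E_x E_sym by (force simp: arcs_def image_iff)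
  moreover have "arcs \<inter> prod.swap ` arcs = {}" by (auto simp: arcs_def)
  ultimately show ?thesis
    using finite_arcs by (simp add: card_Un_disjoint card_image)
qed

lemma card_darts_degree: "card {(u, v). E u v} = (\<Sum>v\<in>V. card {z. E v z})"
proof -
  have "{(u, v). E u v} = (SIGMA v:V. {z. E v z})" using E_V by auto
  then show ?thesis using finite_V finite_nbrs by simp
qed

lemma handshake:
  assumes "S \<subseteq> arcs"
  shows "(\<Sum>v\<in>V. card (S \<inter> incident v)) = 2 * card S"
proof -
  have finS: "finite S" using assms finite_arcs finite_subset by blast
  have "(\<Sum>v\<in>V. card (S \<inter> incident v)) = (\<Sum>v\<in>V. \<Sum>e\<in>S. if e \<in> incident v then 1 else 0)"
    using finS by (simp add: sum.If_cases)
  also have "\<dots> = (\<Sum>e\<in>S. \<Sum>v\<in>V. if e \<in> incident v then 1 else 0)"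
    by (rule sum.swap)
  also have "\<dots> = (\<Sum>e\<in>S. 2)"
  proof (rule sum.cong[OF refl])
    fix e assume "e \<in> S"
    then obtain a b where e: "e = (a, b)" "E a b" "e \<in> arcs" using assms by (auto simp: arcs_def)
    then have "V \<inter> {v. e \<in> incident v} = {a, b}" "a \<noteq> b"
      using E_V E_V2 E_irrefl by (auto simp: incident_def)
    then show "(\<Sum>v\<in>V. if e \<in> incident v then 1 else 0) = (2::nat)"
      using finite_V by (simp add: sum.If_cases)
  qed
  finally show ?thesis by simp
qed

text \<open>
  Faces are the classes \<open>D // R\<close> of darts under the successor \<open>nx\<close>; in the absence of triangles they
  have at least four darts. If there were more arcs than faces and vertices but one, some nonempty
  even \<open>S\<close> would have even parity on every face, although crossing an arc of \<open>S\<close> changes the parity.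
\<close>
lemma card_arcs_less:
  assumes "V \<noteq> {}" and deg: "\<And>v. v \<in> V \<Longrightarrow> card {z. E v z} \<ge> 2"
    and triangle_free: "\<And>a b c. E a b \<Longrightarrow> E b c \<Longrightarrow> \<not> E c a"
  shows "card arcs < 2 * card V"
proof -
  define D where "D = {(u, v). E u v}"
  have finD: "finite D" using finite_darts by (simp add: D_def)
  have "\<exists>nx. \<forall>u v. E u v \<longrightarrow> E v (nx u v) \<and> nx u v \<noteq> u \<and>
    (\<forall>S. even_subgraph S \<longrightarrow> (even (card (S \<inter> lside u v)) \<longleftrightarrow> even (card (S \<inter> lside v (nx u v)))))"
    using next_dart deg E_V2 by (intro choice allI) meson
  then obtain nx where nx': "\<forall>u v. E u v \<longrightarrow> E v (nx u v) \<and> nx u v \<noteq> u \<and>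
    (\<forall>S. even_subgraph S \<longrightarrow> (even (card (S \<inter> lside u v)) \<longleftrightarrow> even (card (S \<inter> lside v (nx u v)))))"
    by (elim exE)
  have nx: "E v (nx u v)" "nx u v \<noteq> u"
    "even_subgraph S \<Longrightarrow> even (card (S \<inter> lside u v)) \<longleftrightarrow> even (card (S \<inter> lside v (nx u v)))"
    if "E u v" for u v S
    using nx'[rule_format, OF that] by auto
  \<comment> \<open>Comparing darts by the \<open>nx\<close>-invariant sets containing them gives an
    equivalence relation without showing that \<open>nx\<close> is a permutation. The darts with
    even left side form such a set, so this parity is constant on each class.\<close>
  define closed where "closed Q \<longleftrightarrow> (\<forall>u v. E u v \<longrightarrow> ((u, v) \<in> Q \<longleftrightarrow> (v, nx u v) \<in> Q))" for Q
  define K where "K d = {Q. closed Q \<and> d \<in> Q}" for d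
  define R where "R = {(d, e) \<in> D \<times> D. K d = K e}"
  have equiv: "equiv D R"
    by (auto simp: R_def equiv_def refl_on_def sym_def trans_def)
  have step: "((u, v), (v, nx u v)) \<in> R" if "E u v" for u v
  proof -
    have "K (u, v) = K (v, nx u v)"
      using that by (auto simp: K_def closed_def)
    then show ?thesis
      using that nx by (simp add: R_def D_def)
  qed
  \<comment> \<open>The starting points of four consecutive darts are pairwise distinct: a
    repetition would be a loop, a step back or a triangle.\<close>
  have four: "4 \<le> card B" if "B \<in> D // R" for B
  proof -
    obtain d where d: "d \<in> D" "B = R `` {d}" using \<open>B \<in> D // R\<close> by (rule quotientE)
    obtain a b where [simp]: "d = (a, b)" by (cases d)
    have ab: "E a b" using d by (auto simp: D_def)
    define c where "c = nx a b"
    define e where "e = nx b c"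
    define f where "f = nx c e"
    have E: "E b c" "c \<noteq> a" "E c e" "e \<noteq> b" "E e f"
      using ab nx(1)[OF ab] nx(2)[OF ab] nx(1)[of b c] nx(2)[of b c] nx(1)[of c e] by (auto simp: c_def e_def f_def)
    have s: "((a, b), (b, c)) \<in> R" "((b, c), (c, e)) \<in> R" "((c, e), (e, f)) \<in> R"
      using step[OF ab] step[OF E(1)] step[OF E(3)] by (auto simp: c_def e_def f_def)
    have tr: "trans R" using equiv by (simp add: equiv_def)
    have "((a, b), (a, b)) \<in> R" using d(1) equiv by (auto simp: equiv_def refl_on_def)
    moreover have s2: "((a, b), (c, e)) \<in> R" using transD[OF tr s(1,2)] .
    moreover have "((a, b), (e, f)) \<in> R" using transD[OF tr s2 s(3)] .
    ultimately have sub: "{(a, b), (b, c), (c, e), (e, f)} \<subseteq> B"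
      using d s by auto
    have "e \<noteq> a" using triangle_free[OF ab E(1)] E(3) by auto
    moreover have "a \<noteq> b" "b \<noteq> c" "c \<noteq> e"
      using E ab E_irrefl by metis+
    ultimately have "card {(a, b), (b, c), (c, e), (e, f)} = 4"
      using E(2,4) by auto
    moreover have "finite B"
      using finD d by (auto simp: R_def intro: finite_subset[of _ D])
    ultimately show ?thesis using sub card_mono by metis
  qed
  have finQ: "finite (D // R)"
    using finD equiv by (simp add: finite_quotient equiv_type)
  have "4 * card (D // R) \<le> (\<Sum>B\<in>D // R. card B)"
    using sum_bounded_below[of "D // R" 4 card] four by (simp add: mult.commute)
  also have "\<dots> = card D"
  proof -
    have "card (\<Union> (D // R)) = (\<Sum>B\<in>D // R. card B)"
      using finD equiv by (intro card_Union_disjoint)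
        (auto simp: pairwise_def disjnt_def dest: quotient_disj finite_equiv_class[OF finD equiv_type])
    then show ?thesis using Union_quotient[OF equiv] by simp
  qed
  finally have faces: "2 * card (D // R) \<le> card arcs"
    using card_darts by (simp add: D_def)
  obtain v0 where v0: "v0 \<in> V" using assms by blast
  define X where "X i = (case i of Inl v \<Rightarrow> incident v | Inr B \<Rightarrow> (case (SOME d. d \<in> B) of (u, v) \<Rightarrow> lside u v))"
    for i :: "'a + ('a \<times> 'a) set"
  \<comment> \<open>The equation at \<open>v0\<close> is left out because \<open>handshake\<close>
    recovers it from the other vertices. The equation saved makes the final inequality
    strict.\<close>
  define I where "I = (V - {v0}) <+> (D // R)"
  have cI: "card I = card V - 1 + card (D // R)" "finite I"
    using finite_V finQ v0 by (auto simp: I_def card_Plus)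
  have "card arcs \<le> card I"
  proof (rule ccontr)
    assume "\<not> ?thesis"
    then obtain S where S: "S \<subseteq> arcs" "S \<noteq> {}" "\<And>i. i \<in> I \<Longrightarrow> even (card (S \<inter> X i))"
      using even_card_inter_family[OF finite_arcs cI(2), of X] by auto
    have ev': "even (card (S \<inter> incident v))" if "v \<in> V" "v \<noteq> v0" for v
      using S(3)[of "Inl v"] that by (auto simp: I_def X_def)
    have "(\<Sum>v\<in>V. card (S \<inter> incident v)) = card (S \<inter> incident v0) + (\<Sum>v\<in>V - {v0}. card (S \<inter> incident v))"
      using finite_V v0 by (rule sum.remove)
    moreover have "even (\<Sum>v\<in>V - {v0}. card (S \<inter> incident v))"
      by (rule dvd_sum) (use ev' in auto)
    ultimately have "even (card (S \<inter> incident v0))"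
      using handshake[OF S(1)] by (metis dvd_add_left_iff dvd_triv_left)
    then have ev: "even (card (S \<inter> incident v))" if "v \<in> V" for v
      using ev' that by blast
    \<comment> \<open>Each face contributes an equation for one representative dart only; invariance
      of \<open>Q\<close> spreads it over the face.\<close>
    have zero: "even (card (S \<inter> lside u v))" if "E u v" for u v
    proof -
      define Q where "Q = {(u, v). even (card (S \<inter> lside u v))}"
      have "closed Q"
        using nx(3) S(1) ev by (auto simp: closed_def Q_def even_subgraph_def)
      define B where "B = R `` {(u, v)}"
      have uvD: "(u, v) \<in> D" using that by (simp add: D_def)
      have B: "B \<in> D // R" unfolding B_def using uvD by (rule quotientI)
      have "(u, v) \<in> B" unfolding B_def using equiv uvD by (rule equiv_class_self)
      then have "(SOME d. d \<in> B) \<in> B" by (rule someI)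
      then obtain p q where pq: "(SOME d. d \<in> B) = (p, q)" "(p, q) \<in> B" by (metis surj_pair)
      have "(p, q) \<in> Q"
        using S(3)[of "Inr B"] B pq by (auto simp: I_def X_def Q_def)
      moreover have "K (u, v) = K (p, q)" using pq by (simp add: B_def R_def)
      ultimately have "(u, v) \<in> Q" using \<open>closed Q\<close> by (auto simp: K_def)
      then show ?thesis by (simp add: Q_def)
    qed
    obtain a b where ab: "(a, b) \<in> S" using S(2) by auto
    then have E: "E a b" "edge a b = (a, b)" using S(1) by (auto simp: arcs_def edge_def)
    \<comment> \<open>Both sides of an arc of \<open>S\<close> turn out even, although they differ
      by that one arc.\<close>
    have "even (card (S \<inter> rside a b))"
      using transport[OF S(1) ev E_sym[OF E(1)]] zero[OF E_sym[OF E(1)]] by simp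
    then show False
      using zero[OF E(1)] card_lside[OF S(1) E(1)] ab E by simp
  qed
  moreover have "card V > 0" using v0 finite_V by (auto simp: card_gt_0_iff)
  ultimately show ?thesis using faces cI by linarith
qed

lemma exists_degree_le_3:
  assumes "V \<noteq> {}"
    and triangle_free: "\<And>a b c. E a b \<Longrightarrow> E b c \<Longrightarrow> \<not> E c a"
  shows "\<exists>v\<in>V. card {z. E v z} \<le> 3"
proof (rule ccontr)
  assume "\<not> ?thesis"
  then have four: "4 \<le> card {z. E v z}" if "v \<in> V" for v using that by force
  have "4 * card V \<le> (\<Sum>v\<in>V. card {z. E v z})"
    using sum_bounded_below[of V 4 "\<lambda>v. card {z. E v z}"] four by (simp add: mult.commute)
  also have "\<dots> = 2 * card arcs" using card_darts card_darts_degree by simp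
  also have "card arcs < 2 * card V"
    using four by (intro card_arcs_less assms(1) triangle_free) force+
  finally show False by simp
qed

end

subsection \<open>Hall's theorem\<close>

text \<open>Induction on the total size of the sets. While some set has two elements, one of them
  can be deleted without violating Hall's condition; once all sets are singletons, the condition for
  pairs of indices makes them distinct.\<close>

lemma hall_marriage:
  fixes N :: "'a \<Rightarrow> 'b set"
  assumes "finite I" "\<And>i. i \<in> I \<Longrightarrow> finite (N i)"
    and "\<And>J. J \<subseteq> I \<Longrightarrow> card J \<le> card (\<Union>i\<in>J. N i)"
  shows "\<exists>f. inj_on f I \<and> (\<forall>i\<in>I. f i \<in> N i)"
  using assms
proof (induction "\<Sum>i\<in>I. card (N i)" arbitrary: N rule: less_induct)
  case less
  note finN = less.prems(2) and H = less.prems(3)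
  show ?case
  proof (cases "\<exists>i\<in>I. \<exists>a\<in>N i. \<exists>b\<in>N i. a \<noteq> b")
    case False
    have ne: "N i \<noteq> {}" if "i \<in> I" for i
      using H[of "{i}"] that by auto
    define f where "f i = (SOME a. a \<in> N i)" for i
    have f: "N i = {f i}" if "i \<in> I" for i
      using ne[OF that] False that someI_ex[of "\<lambda>a. a \<in> N i"] unfolding f_def by blast
    have "inj_on f I"
    proof (rule inj_onI, rule ccontr)
      fix i j assume ij: "i \<in> I" "j \<in> I" "f i = f j" "i \<noteq> j"
      then have "(\<Union>k\<in>{i, j}. N k) = {f i}" using f by auto
      then show False using H[of "{i, j}"] ij by simp
    qed
    then show ?thesis using f by blast
  next
    case True
    then obtain i a b where i: "i \<in> I" "a \<in> N i" "b \<in> N i" "a \<noteq> b" by blast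
    define M where "M z = N(i := N i - {z})" for z
    have M_sub: "M z k \<subseteq> N k" for z k by (auto simp: M_def)
    have finM: "finite (M z k)" if "k \<in> I" for z k
      using finite_subset[OF M_sub finN[OF that]] .
    have M_less: "(\<Sum>k\<in>I. card (M z k)) < (\<Sum>k\<in>I. card (N k))" if "z \<in> N i" for z
    proof (rule sum_strict_mono_ex1[OF less.prems(1)])
      show "\<forall>k\<in>I. card (M z k) \<le> card (N k)"
        using card_mono[OF finN M_sub] by blast
      show "\<exists>k\<in>I. card (M z k) < card (N k)"
        using i(1) card_Diff1_less[OF finN[OF i(1)] that] by (intro bexI[of _ i]) (simp_all add: M_def)
    qed
    \<comment> \<open>Rado: if deleting \<open>a\<close> and deleting \<open>b\<close> both broke Hall's condition, then by submodularity the
      union or the intersection of the two violating sets would break it already.\<close>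
    have "\<exists>z\<in>{a, b}. \<forall>J\<subseteq>I. card J \<le> card (\<Union>k\<in>J. M z k)"
    proof (rule ccontr)
      assume "\<not> ?thesis"
      then obtain A B where A: "A \<subseteq> I" "card (\<Union>k\<in>A. M a k) < card A"
        and B: "B \<subseteq> I" "card (\<Union>k\<in>B. M b k) < card B"
        by (metis insertCI not_less)
      have fin: "finite A" "finite B" using A B less.prems(1) finite_subset by auto
      have mem: "i \<in> J" if "J \<subseteq> I" "card (\<Union>k\<in>J. M z k) < card J" for J z
      proof (rule ccontr)
        assume "i \<notin> J"
        then have "(\<Union>k\<in>J. M z k) = (\<Union>k\<in>J. N k)" by (auto simp: M_def)
        then show False using H[OF that(1)] that(2) by simp
      qed
      have iA: "i \<in> A" and iB: "i \<in> B" using mem A B by blast+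
      have fU: "finite (\<Union>k\<in>A. M a k)" "finite (\<Union>k\<in>B. M b k)"
        using fin finM A B by blast+
      have "card (A \<union> B) \<le> card (\<Union>k\<in>A \<union> B. N k)"
        using A(1) B(1) by (intro H) simp
      \<comment> \<open>Since \<open>a\<close> and \<open>b\<close> differ, \<open>N i\<close>
        without \<open>a\<close> and \<open>N i\<close> without \<open>b\<close> together restore
        \<open>N i\<close>.\<close>
      also have "\<dots> \<le> card ((\<Union>k\<in>A. M a k) \<union> (\<Union>k\<in>B. M b k))"
        by (rule card_mono) (use fU i iA iB in \<open>auto simp: M_def split: if_splits\<close>)
      finally have 1: "card (A \<union> B) \<le> card ((\<Union>k\<in>A. M a k) \<union> (\<Union>k\<in>B. M b k))" .
      have "card (A \<inter> B - {i}) \<le> card (\<Union>k\<in>A \<inter> B - {i}. N k)"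
        using A by (intro H) auto
      also have "\<dots> \<le> card ((\<Union>k\<in>A. M a k) \<inter> (\<Union>k\<in>B. M b k))"
        by (rule card_mono) (use fU in \<open>auto simp: M_def\<close>)
      finally have 2: "card (A \<inter> B - {i}) \<le> card ((\<Union>k\<in>A. M a k) \<inter> (\<Union>k\<in>B. M b k))" .
      \<comment> \<open>Omitting \<open>i\<close> from the intersection loses one, whereas the two
        strict violations gain two.\<close>
      have "card (A \<inter> B - {i}) = card (A \<inter> B) - 1" "card (A \<inter> B) > 0"
        using iA iB fin by (auto simp: card_gt_0_iff)
      then show False
        using 1 2 A(2) B(2) card_Un_Int[OF fin] card_Un_Int[OF fU] by linarith
    qed
    then obtain z where z: "z \<in> {a, b}" "\<And>J. J \<subseteq> I \<Longrightarrow> card J \<le> card (\<Union>k\<in>J. M z k)"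
      by blast
    then have "z \<in> N i" using i by auto
    from less.hyps[OF M_less[OF this] less.prems(1) finM z(2)]
    show ?thesis using M_sub by blast
  qed
qed

subsection \<open>Vertex covers and clique packings\<close>

text \<open>Support inside \<open>W\<close> allows packings on disjoint vertex sets to be added. The
  bound \<open>x C \<le> 1\<close> follows from the constraint at any vertex of the clique
  \<open>C\<close>, see \<open>packs_le_FCP\<close>.\<close>

definition packs :: "'a pair_pre_digraph \<Rightarrow> 'a set \<Rightarrow> real \<Rightarrow> bool" where
  "packs G W s \<longleftrightarrow> (\<exists>x. (\<forall>C. 0 \<le> x C) \<and> (\<forall>C. x C \<noteq> 0 \<longrightarrow> C \<subseteq> W) \<and>
     (\<forall>v\<in>W. (\<Sum>C | C \<in> cliques G \<and> v \<in> C. x C) \<le> 1) \<and> packing_value G x = s)"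

lemma packs_Un:
  assumes "finite (pverts G)" "packs G W s" "packs G W' s'" "W \<inter> W' = {}"
  shows "packs G (W \<union> W') (s + s')"
proof -
  obtain x where x: "\<And>C. 0 \<le> x C" "\<And>C. x C \<noteq> 0 \<Longrightarrow> C \<subseteq> W"
    "\<And>v. v \<in> W \<Longrightarrow> (\<Sum>C | C \<in> cliques G \<and> v \<in> C. x C) \<le> 1" "packing_value G x = s"
    using assms(2) unfolding packs_def by blast
  obtain x' where x': "\<And>C. 0 \<le> x' C" "\<And>C. x' C \<noteq> 0 \<Longrightarrow> C \<subseteq> W'"
    "\<And>v. v \<in> W' \<Longrightarrow> (\<Sum>C | C \<in> cliques G \<and> v \<in> C. x' C) \<le> 1" "packing_value G x' = s'"
    using assms(3) unfolding packs_def by blast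
  have z: "(\<Sum>C | C \<in> cliques G \<and> v \<in> C. x C) = 0" if "v \<in> W'" for v
    using that x(2) assms(4) by (intro sum.neutral) blast
  have z': "(\<Sum>C | C \<in> cliques G \<and> v \<in> C. x' C) = 0" if "v \<in> W" for v
    using that x'(2) assms(4) by (intro sum.neutral) blast
  show ?thesis
    unfolding packs_def
  proof (intro exI[of _ "\<lambda>C. x C + x' C"] conjI allI impI ballI)
    show "packing_value G (\<lambda>C. x C + x' C) = s + s'"
      using x(4) x'(4) by (simp add: packing_value_def distrib_right sum.distrib)
    show "C \<subseteq> W \<union> W'" if "x C + x' C \<noteq> 0" for C
      using that x(2)[of C] x'(2)[of C] by (cases "x C = 0") auto
    show "(\<Sum>C | C \<in> cliques G \<and> v \<in> C. x C + x' C) \<le> 1" if "v \<in> W \<union> W'" for v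
      using that z[of v] z'[of v] x(3)[of v] x'(3)[of v] by (auto simp: sum.distrib)
  qed (use x(1) x'(1) in auto)
qed

lemma packs_clique:
  assumes "finite (pverts G)" "C \<in> cliques G"
  shows "packs G C (real (card C) - 1)"
  unfolding packs_def
proof (intro exI[of _ "\<lambda>D. if D = C then 1 else 0"] conjI allI impI ballI)
  have fin: "finite (cliques G)" using assms(1) by (rule finite_cliques)
  show "(\<Sum>D | D \<in> cliques G \<and> v \<in> D. if D = C then 1 else 0) \<le> (1::real)" for v
    using fin by (simp add: sum.delta)
  have "packing_value G (\<lambda>D. if D = C then 1 else 0) = (\<Sum>D\<in>cliques G. if D = C then real (card D) - 1 else 0)"
    unfolding packing_value_def by (rule sum.cong) auto
  then show "packing_value G (\<lambda>D. if D = C then 1 else 0) = real (card C) - 1"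
    using fin assms(2) by simp
qed (auto split: if_splits)

text \<open>A vertex lies in at most two of the pairs of \<open>v\<close> and \<open>f v\<close>:
  once as \<open>v\<close> and, by injectivity, once as an image. If \<open>A\<close> and its image
  are disjoint, only one of these occurs and weight 1 is possible.\<close>

lemma packs_edges:
  assumes G: "pair_graph G" and A: "A \<subseteq> W" "finite A" and inj: "inj_on f A" and fW: "f ` A \<subseteq> W"
    and arc: "\<And>v. v \<in> A \<Longrightarrow> (v, f v) \<in> parcs G"
    and k: "0 \<le> k" "k \<le> 1" "A \<inter> f ` A = {} \<or> k \<le> 1 / 2"
  shows "packs G W (k * real (card A))"
proof -
  interpret pair_graph G by (rule G)
  have fin: "finite (cliques G)" by (rule finite_cliques) simp
  define e where "e v = {v, f v}" for v
  have sym: "(f v, v) \<in> parcs G" if "v \<in> A" for v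
    using arc[OF that] by (rule arcs_symmetric)
  have ne: "v \<noteq> f v" if "v \<in> A" for v
    using pair_no_loops[OF arc[OF that]] by simp
  have e: "e v \<in> cliques G" if "v \<in> A" for v
    using arc[OF that] sym[OF that] arc_fst_in_verts[of "(v, f v)"] arc_snd_in_verts[of "(v, f v)"]
    by (auto simp: cliques_def e_def)
  \<comment> \<open>Weights are summed because a 2-cycle of \<open>f\<close> yields the same pair
    from both of its vertices.\<close>
  define x where "x C = (\<Sum>v | v \<in> A \<and> e v = C. k)" for C
  have group: "(\<Sum>C\<in>T. x C * g C) = (\<Sum>v | v \<in> A \<and> e v \<in> T. k * g (e v))"
    if "finite T" for T and g :: "'a set \<Rightarrow> real"
  proof -
    have "(\<Sum>C\<in>T. x C * g C) = (\<Sum>C\<in>T. \<Sum>v | v \<in> {v \<in> A. e v \<in> T} \<and> e v = C. k * g (e v))"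
      unfolding x_def sum_distrib_right by (intro sum.cong) auto
    also have "\<dots> = (\<Sum>v | v \<in> A \<and> e v \<in> T. k * g (e v))"
      using that A(2) by (intro sum.group) auto
    finally show ?thesis .
  qed
  show ?thesis
    unfolding packs_def
  proof (intro exI[of _ x] conjI allI impI ballI)
    show "0 \<le> x C" for C using k by (auto simp: x_def)
    show "C \<subseteq> W" if "x C \<noteq> 0" for C
    proof -
      have "{v. v \<in> A \<and> e v = C} \<noteq> {}" using that unfolding x_def by (metis sum.empty)
      then show ?thesis using A fW by (auto simp: e_def)
    qed
    have "packing_value G x = (\<Sum>v | v \<in> A \<and> e v \<in> cliques G. k * (real (card (e v)) - 1))"
      unfolding packing_value_def using group[OF fin] .
    also have "\<dots> = (\<Sum>v\<in>A. k)"
      using e ne by (intro sum.cong) (auto simp: e_def)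
    finally show "packing_value G x = k * real (card A)" by simp
    fix w assume "w \<in> W"
    have "(\<Sum>C | C \<in> cliques G \<and> w \<in> C. x C) = (\<Sum>v | v \<in> A \<and> (e v \<in> cliques G \<and> w \<in> e v). k)"
      using group[of "{C. C \<in> cliques G \<and> w \<in> C}" "\<lambda>_. 1"] fin by simp
    also have "\<dots> = k * card ({v \<in> A. v = w} \<union> {v \<in> A. f v = w})"
      using e by (auto simp: e_def intro!: arg_cong[of _ _ card])
    also have "\<dots> \<le> 1"
    proof -
      have 1: "card {v \<in> A. v = w} \<le> 1" using A by (auto simp: card_le_Suc0_iff_eq)
      have 2: "card {v \<in> A. f v = w} \<le> 1"
        using A inj by (auto simp: card_le_Suc0_iff_eq inj_on_def)
      have 3: "card ({v \<in> A. v = w} \<union> {v \<in> A. f v = w}) \<le> card {v \<in> A. v = w} + card {v \<in> A. f v = w}"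
        by (rule card_Un_le)
      show ?thesis
      proof (cases "A \<inter> f ` A = {}")
        case True
        then have "{v \<in> A. v = w} = {} \<or> {v \<in> A. f v = w} = {}" by blast
        then have "card ({v \<in> A. v = w} \<union> {v \<in> A. f v = w}) \<le> 1"
          using 1 2 by (elim disjE) (simp_all only: Un_empty_left Un_empty_right)
        then have "k * card ({v \<in> A. v = w} \<union> {v \<in> A. f v = w}) \<le> 1 * 1"
          using k by (intro mult_mono) auto
        then show ?thesis by simp
      next
        case False
        then have "k * card ({v \<in> A. v = w} \<union> {v \<in> A. f v = w}) \<le> 1 / 2 * 2"
          using k 1 2 3 by (intro mult_mono) auto
        then show ?thesis by simp
      qed
    qed
    finally show "(\<Sum>C | C \<in> cliques G \<and> w \<in> C. x C) \<le> 1" .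
  qed
qed

lemma packs_le_FCP:
  assumes "finite (pverts G)" "packs G W s"
  shows "s \<le> FCP G"
proof -
  obtain x where x: "\<And>C. 0 \<le> x C" "\<And>C. x C \<noteq> 0 \<Longrightarrow> C \<subseteq> W"
    "\<And>v. v \<in> W \<Longrightarrow> (\<Sum>C | C \<in> cliques G \<and> v \<in> C. x C) \<le> 1" "packing_value G x = s"
    using assms(2) unfolding packs_def by blast
  have fin: "finite (cliques G)" using assms(1) by (rule finite_cliques)
  have vertex: "(\<Sum>C | C \<in> cliques G \<and> v \<in> C. x C) \<le> 1" for v
  proof (cases "v \<in> W")
    case False
    then have "(\<Sum>C | C \<in> cliques G \<and> v \<in> C. x C) = 0"
      using x(2) by (intro sum.neutral) blast
    then show ?thesis by simp
  qed (use x(3) in blast)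
  have "x C \<le> 1" if C: "C \<in> cliques G" for C
  proof -
    obtain v where "v \<in> C" using C by (auto simp: cliques_def)
    then have "x C \<le> (\<Sum>C | C \<in> cliques G \<and> v \<in> C. x C)"
      using C fin x(1) by (intro member_le_sum) auto
    then show ?thesis using vertex[of v] by simp
  qed
  then have "x \<in> frac_clique_packings G"
    using x(1) vertex by (auto simp: frac_clique_packings_def)
  then show ?thesis
    using FCP_is_maximum[OF assms(1)] x(4) by blast
qed

section \<open>Vertex covers bound the capacity\<close>

lemma capacity_le_vertex_cover:
  assumes G: "pair_graph G" and C: "C \<subseteq> pverts G" "\<And>u v. (u, v) \<in> parcs G \<Longrightarrow> u \<in> C \<or> v \<in> C"
  shows "capacity G \<le> real (card C)"
proof -
  interpret pair_graph G by (rule G)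
  have finC: "finite C" using C(1) pair_finite_verts finite_subset by metis
  have "capacity_q q G \<le> real (card C)" if q: "2 \<le> q" for q
    unfolding capacity_q_def
  proof (rule Max.boundedI)
    show "finite ((\<lambda>\<C>. log (real q) (real (card \<C>))) ` {\<C>. rdss_code G {..<q} \<C>})"
      using finite_rdss_codes[of G "{..<q}"] by simp
    show "(\<lambda>\<C>. log (real q) (real (card \<C>))) ` {\<C>. rdss_code G {..<q} \<C>} \<noteq> {}"
      using rdss_code_singleton[of 0 "{..<q}" G] q by auto
    fix s assume "s \<in> (\<lambda>\<C>. log (real q) (real (card \<C>))) ` {\<C>. rdss_code G {..<q} \<C>}"
    then obtain \<C> where \<C>: "rdss_code G {..<q} \<C>" and s: "s = log (real q) (real (card \<C>))"
      by auto
    obtain g where g: "\<And>X v. X \<in> \<C> \<Longrightarrow> v \<in> pverts G \<Longrightarrow> g v (restrict X (neighbours G v)) = X v"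
      and sub: "\<C> \<subseteq> (\<Pi>\<^sub>E v\<in>pverts G. {..<q})" and ne: "\<C> \<noteq> {}"
      using \<C> unfolding rdss_code_def by blast
    have "inj_on (\<lambda>X. restrict X C) \<C>"
    proof (rule inj_onI)
      fix X Y assume XY: "X \<in> \<C>" "Y \<in> \<C>" "restrict X C = restrict Y C"
      have onC: "X v = Y v" if "v \<in> C" for v
        using XY(3) that by (metis restrict_apply')
      show "X = Y"
      proof (rule extensionalityI[of _ "pverts G"])
        show "X \<in> extensional (pverts G)" "Y \<in> extensional (pverts G)"
          using XY sub by (auto simp: PiE_def)
        fix v assume v: "v \<in> pverts G"
        show "X v = Y v"
        proof (cases "v \<in> C")
          case False
          \<comment> \<open>All neighbours of an uncovered vertex are covered, so its recovery
            function reads the same values in both words.\<close>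
          then have "neighbours G v \<subseteq> C"
            using C(2) by (auto simp: neighbours_def)
          then have "restrict X (neighbours G v) = restrict Y (neighbours G v)"
            using onC by (auto simp: restrict_def fun_eq_iff)
          then show ?thesis using g[OF XY(1) v] g[OF XY(2) v] by simp
        qed (rule onC)
      qed
    qed
    moreover have "(\<lambda>X. restrict X C) ` \<C> \<subseteq> (\<Pi>\<^sub>E v\<in>C. {..<q})"
      using sub C(1) by (auto simp: PiE_iff) (metis PiE_mem lessThan_iff subsetD)
    moreover have "finite (\<Pi>\<^sub>E v\<in>C. {..<q})" using finC by (simp add: finite_PiE)
    ultimately have "card \<C> \<le> card (\<Pi>\<^sub>E v\<in>C. {..<q})"
      by (rule card_inj_on_le)
    then have "card \<C> \<le> q ^ card C"
      using finC by (simp add: card_PiE)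
    then have le: "real (card \<C>) \<le> real q ^ card C"
      by (metis of_nat_le_iff of_nat_power)
    have "finite \<C>" using sub by (rule finite_subset) (simp add: finite_PiE)
    then have "0 < card \<C>" using ne by (simp add: card_gt_0_iff)
    then have "log (real q) (real (card \<C>)) \<le> log (real q) (real q ^ card C)"
      using le q by (subst log_le_cancel_iff) auto
    then show "s \<le> real (card C)"
      using q s by (simp add: log_nat_power)
  qed
  then show ?thesis
    unfolding capacity_def by (intro cSUP_least) auto
qed

text \<open>
  Crown decomposition: for an independent set \<open>I\<close> maximising \<open>card I - card (N I)\<close>, Hall's theorem
  matches \<open>N I\<close> into \<open>I\<close> and permutes the remaining vertices along edges, which gives the weights
  \<open>1\<close> and \<open>1/2\<close>. The cover takes \<open>N I\<close> and all but the largest colour class of the rest.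
\<close>
lemma vertex_cover_le_packing_if_4_colourable:
  assumes G: "pair_graph G" and W: "W \<subseteq> pverts G"
    and col: "\<And>v. v \<in> W \<Longrightarrow> col v < (4::nat)"
      "\<And>u v. u \<in> W \<Longrightarrow> v \<in> W \<Longrightarrow> (u, v) \<in> parcs G \<Longrightarrow> col u \<noteq> col v"
  shows "\<exists>C s. C \<subseteq> W \<and> (\<forall>u\<in>W. \<forall>v\<in>W. (u, v) \<in> parcs G \<longrightarrow> u \<in> C \<or> v \<in> C) \<and>
    packs G W s \<and> real (card C) \<le> 3 / 2 * s"
proof -
  interpret pair_graph G by (rule G)
  have finW: "finite W" using W pair_finite_verts finite_subset by metis
  define N where "N S = {u\<in>W. \<exists>s\<in>S. (s, u) \<in> parcs G}" for S
  define \<I> where "\<I> = {S. S \<subseteq> W \<and> S \<inter> N S = {}}"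
  define val where "val S = int (card S) - int (card (N S))" for S
  have fin: "finite (S::'a set)" if "S \<subseteq> W" for S using that finW finite_subset by auto
  have finN: "finite (N S)" for S by (rule fin) (auto simp: N_def)
  have fI: "finite \<I>" by (rule finite_subset[of _ "Pow W"]) (use finW in \<open>auto simp: \<I>_def\<close>)
  have "{} \<in> \<I>" by (auto simp: \<I>_def)
  then obtain I where I: "I \<in> \<I>" "Max (val ` \<I>) = val I"
    using obtains_MAX[OF fI] by (metis empty_iff)
  have max: "val S \<le> val I" if "S \<in> \<I>" for S
    using Max_ge[of "val ` \<I>" "val S"] that fI I(2) by simp
  have IW: "I \<subseteq> W" and indep: "I \<inter> N I = {}" using I(1) by (auto simp: \<I>_def)
  define K where "K = N I"
  define R where "R = W - I - K"
  have KW: "K \<subseteq> W" by (auto simp: K_def N_def)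
  have RW: "R \<subseteq> W" by (auto simp: R_def)
  have "\<exists>m. inj_on m K \<and> (\<forall>a\<in>K. m a \<in> {i\<in>I. (a, i) \<in> parcs G})"
  proof (rule hall_marriage)
    fix A assume A: "A \<subseteq> K"
    \<comment> \<open>Deleting \<open>B\<close> from \<open>I\<close> removes all of
      \<open>A\<close> from the neighbourhood, so \<open>card B < card A\<close> would contradict
      the maximality of \<open>val I\<close>.\<close>
    define B where "B = (\<Union>a\<in>A. {i\<in>I. (a, i) \<in> parcs G})"
    have B: "B \<subseteq> I" by (auto simp: B_def)
    have NI: "N (I - B) \<subseteq> K - A"
      using arcs_symmetric by (auto simp: N_def K_def B_def)
    have "I - B \<in> \<I>"
      using IW indep NI by (auto simp: \<I>_def K_def)
    then have "int (card (I - B)) - int (card (N (I - B))) \<le> int (card I) - int (card K)"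
      using max by (simp add: val_def K_def)
    moreover have "card (N (I - B)) \<le> card (K - A)"
      using NI fin[OF KW] by (intro card_mono) auto
    moreover have "card (K - A) + card A = card K"
      using A fin[OF KW] by (metis card_Diff_subset card_mono finite_subset le_add_diff_inverse2)
    moreover have "card (I - B) + card B = card I"
      using B fin[OF IW] by (metis card_Diff_subset card_mono finite_subset le_add_diff_inverse2)
    ultimately have "card A \<le> card B" by linarith
    then show "card A \<le> card (\<Union>a\<in>A. {i\<in>I. (a, i) \<in> parcs G})" by (simp add: B_def)
  qed (use fin[OF KW] fin[OF IW] in auto)
  then obtain m where m: "inj_on m K" "\<And>a. a \<in> K \<Longrightarrow> m a \<in> I" "\<And>a. a \<in> K \<Longrightarrow> (a, m a) \<in> parcs G"
    by blast
  have "packs G (I \<union> K) (1 * real (card K))"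
    by (rule packs_edges[OF G _ fin[OF KW] m(1)]) (use m(2,3) indep in \<open>auto simp: K_def\<close>)
  then have pK: "packs G (I \<union> K) (real (card K))" by simp
  have "\<exists>t. inj_on t R \<and> (\<forall>a\<in>R. t a \<in> {u\<in>R. (a, u) \<in> parcs G})"
  proof (rule hall_marriage)
    fix S assume S: "S \<subseteq> R"
    \<comment> \<open>Vertices of \<open>S\<close> with a neighbour in \<open>S\<close> belong to
      \<open>N S\<close> and pay for themselves. The remaining ones, \<open>S0\<close>, can be added
      to the independent set \<open>I\<close>, so by maximality they have at least
      \<open>card S0\<close> neighbours in \<open>R\<close>, and none of these lies in
      \<open>S\<close>.\<close>
    define S0 where "S0 = S - N S"
    define M where "M T = N T \<inter> R" for T
    have IR: "(i, u) \<notin> parcs G" "(u, i) \<notin> parcs G" if "i \<in> I" "u \<in> R" for i u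
      using that RW arcs_symmetric[of u i] by (auto simp: R_def K_def N_def)
    have "I \<union> S0 \<in> \<I>"
      using IW S RW indep IR by (auto simp: \<I>_def S0_def N_def)
    then have "val (I \<union> S0) \<le> val I" by (rule max)
    moreover have "N (I \<union> S0) \<subseteq> K \<union> M S0"
    proof
      fix u assume u: "u \<in> N (I \<union> S0)"
      show "u \<in> K \<union> M S0"
      proof (rule ccontr)
        assume nu: "u \<notin> K \<union> M S0"
        then obtain s where s: "s \<in> S0" "(s, u) \<in> parcs G"
          using u by (auto simp: N_def K_def)
        moreover have "s \<in> R" using s(1) S by (auto simp: S0_def)
        ultimately have "u \<notin> I" using IR(2) by blast
        then have "u \<in> M S0" using u nu s by (auto simp: M_def R_def N_def)
        then show False using nu by blast
      qed
    qed
    then have "card (N (I \<union> S0)) \<le> card K + card (M S0)"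
      using card_mono[of "K \<union> M S0" "N (I \<union> S0)"] card_Un_le[of K "M S0"] finN fin[OF KW]
      by (simp add: M_def)
    moreover have "card (I \<union> S0) = card I + card S0"
      using S RW IW by (intro card_Un_disjoint fin) (auto simp: S0_def R_def)
    ultimately have "card S0 \<le> card (M S0)"
      unfolding val_def K_def by linarith
    moreover have finS: "finite S"
      using S fin[OF RW] finite_subset by blast
    have "S \<inter> S0 = S0" by (auto simp: S0_def)
    then have "card S = card S0 + card (S - S0)"
      using card_Int_Diff[OF finS, of S0] by simp
    moreover have "card (M S0 \<union> (S - S0)) = card (M S0) + card (S - S0)"
    proof (rule card_Un_disjoint)
      have "s \<in> N S" if "x \<in> S" "s \<in> S" "(s, x) \<in> parcs G" for s x
        using that S RW arcs_symmetric[OF that(3)] by (auto simp: N_def)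
      then show "M S0 \<inter> (S - S0) = {}"
        by (auto simp: M_def S0_def) (auto simp: N_def)
    qed (use finN finS in \<open>simp_all add: M_def\<close>)
    moreover have "card (M S0 \<union> (S - S0)) \<le> card (M S)"
      using finN S RW by (intro card_mono) (auto simp: M_def S0_def N_def)
    ultimately have "card S \<le> card (M S)" by linarith
    moreover have "M S = (\<Union>a\<in>S. {u\<in>R. (a, u) \<in> parcs G})"
      using RW by (auto simp: M_def N_def)
    ultimately show "card S \<le> card (\<Union>a\<in>S. {u\<in>R. (a, u) \<in> parcs G})" by simp
  qed (use fin[OF RW] in auto)
  then obtain t where t: "inj_on t R" "\<And>a. a \<in> R \<Longrightarrow> t a \<in> R" "\<And>a. a \<in> R \<Longrightarrow> (a, t a) \<in> parcs G"
    by blast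
  have pR: "packs G R (1 / 2 * real (card R))"
    by (rule packs_edges[OF G _ fin[OF RW] t(1)]) (use t(2,3) in auto)
  have pW: "packs G W (real (card K) + 1 / 2 * real (card R))"
  proof -
    have "W = (I \<union> K) \<union> R" using IW KW by (auto simp: R_def)
    then show ?thesis
      using packs_Un[OF _ pK pR] by (auto simp: R_def)
  qed
  define Rj where "Rj j = {v\<in>R. col v = j}" for j
  have "card R = (\<Sum>j<4. card (Rj j))"
  proof -
    have "(\<Sum>j<4. \<Sum>v | v \<in> R \<and> col v = j. 1) = (\<Sum>v\<in>R. 1::nat)"
      using fin[OF RW] col(1) RW by (intro sum.group) auto
    then show ?thesis by (simp add: Rj_def)
  qed
  moreover have "(\<Sum>j<4. 4 * card (Rj j)) < (\<Sum>j<4::nat. card R)" if "\<forall>j<4. 4 * card (Rj j) < card R"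
    using that by (intro sum_strict_mono) (auto simp: lessThan_empty_iff)
  ultimately have "\<not> (\<forall>j<4. 4 * card (Rj j) < card R)"
    by (auto simp: sum_distrib_left[symmetric])
  then obtain j where j: "card R \<le> 4 * card (Rj j)" by (auto simp: not_less)
  define C where "C = K \<union> (R - Rj j)"
  have RjR: "Rj j \<subseteq> R" by (auto simp: Rj_def)
  have "card C \<le> card K + card (R - Rj j)" unfolding C_def by (rule card_Un_le)
  also have "card (R - Rj j) = card R - card (Rj j)"
    using RjR fin[OF RW] by (metis card_Diff_subset finite_subset)
  finally have "4 * real (card C) \<le> 4 * real (card K) + 3 * real (card R)"
    using j card_mono[OF fin[OF RW] RjR] by linarith
  then have "real (card C) \<le> 3 / 2 * (real (card K) + 1 / 2 * real (card R))"
    by simp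
  moreover have "u \<in> C \<or> v \<in> C" if uv: "u \<in> W" "v \<in> W" "(u, v) \<in> parcs G" for u v
  proof -
    have "v \<in> K" if "u \<in> I" using that uv by (auto simp: K_def N_def)
    moreover have "u \<in> K" if "v \<in> I"
      using that uv arcs_symmetric[OF uv(3)] by (auto simp: K_def N_def)
    moreover have "u \<notin> Rj j \<or> v \<notin> Rj j" using col(2)[OF uv] by (auto simp: Rj_def)
    ultimately show ?thesis using uv by (auto simp: C_def R_def)
  qed
  moreover have "C \<subseteq> W" using KW RW by (auto simp: C_def)
  ultimately show ?thesis using pW by blast
qed

subsection \<open>Disk graphs\<close>

text \<open>The centres need not give a proper drawing: a small disk meeting only the disk of
  \<open>u\<close> may be centred on an edge at \<open>u\<close>. Assuming that all degrees are at
  least 4 removes this obstacle, as every vertex then has a neighbour outside any two given vertices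
  (\<open>another\<close>).\<close>

lemma disks_degree_le_3:
  fixes c :: "'a \<Rightarrow> real ^ 2" and r :: "'a \<Rightarrow> real"
  assumes W: "finite W" "W \<noteq> {}"
    and E: "\<And>u v. E u v \<longleftrightarrow> u \<in> W \<and> v \<in> W \<and> u \<noteq> v \<and> dist (c u) (c v) \<le> r u + r v"
    and triangle_free: "\<And>a b c. E a b \<Longrightarrow> E b c \<Longrightarrow> \<not> E c a"
  shows "\<exists>v\<in>W. card {z. E v z} \<le> 3"
proof (rule ccontr)
  assume neg: "\<not> ?thesis"
  have E_sym: "E u v \<Longrightarrow> E v u" for u v by (auto simp: E dist_commute add.commute)
  have another: "\<exists>z. E w z \<and> z \<noteq> a \<and> z \<noteq> b" if "w \<in> W" for w a b
  proof (rule ccontr)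
    assume "\<not> ?thesis"
    then have "{z. E w z} \<subseteq> {a, b}" by auto
    then have "card {z. E w z} \<le> card {a, b}" by (intro card_mono) auto
    also have "\<dots> \<le> 2" by (simp add: card_insert_if)
    finally show False using neg that by force
  qed
  \<comment> \<open>Two crossing edges without a common vertex force two further adjacencies, hence a triangle.\<close>
  have disjoint: False
    if ab: "E a b" and uv: "E u v" and dj: "{a, b} \<inter> {u, v} = {}"
      and p: "p \<in> closed_segment (c a) (c b)" "p \<in> closed_segment (c u) (c v)" for a b u v p
  proof -
    have d: "dist (c a) (c b) = dist (c a) p + dist p (c b)" "dist (c u) (c v) = dist (c u) p + dist p (c v)"
      using p by (simp_all add: between_mem_segment[symmetric] between)
    have le: "dist (c a) (c b) \<le> r a + r b" "dist (c u) (c v) \<le> r u + r v"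
      using ab uv by (auto simp: E)
    have "dist (c a) (c u) + dist (c b) (c v) \<le> (r a + r u) + (r b + r v)"
      using d le dist_triangle[of "c a" "c u" p] dist_triangle[of "c b" "c v" p]
      by (simp add: dist_commute)
    then have 1: "E a u \<or> E b v"
      using ab uv dj by (auto simp: E)
    have "dist (c a) (c v) + dist (c b) (c u) \<le> (r a + r v) + (r b + r u)"
      using d le dist_triangle[of "c a" "c v" p] dist_triangle[of "c b" "c u" p]
      by (simp add: dist_commute)
    then have 2: "E a v \<or> E b u"
      using ab uv dj by (auto simp: E)
    show False
      using 1 2 ab uv E_sym triangle_free by meson
  qed
  \<comment> \<open>A degenerate crossing: an edge from \<open>w\<close> to a neighbour other than
    \<open>u\<close> and \<open>v\<close> would meet the edge at \<open>c w\<close>.\<close>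
  have not_on: "c w \<notin> closed_segment (c u) (c v)" if "E u v" "w \<in> W" "w \<noteq> u" "w \<noteq> v" for u v w
  proof -
    obtain z where "E w z" "z \<noteq> u" "z \<noteq> v" using another \<open>w \<in> W\<close> by blast
    then show ?thesis using disjoint[of w z u v "c w"] that by auto
  qed
  have c_inj: "c u \<noteq> c v" if uv: "u \<in> W" "v \<in> W" "u \<noteq> v" for u v
  proof
    assume "c u = c v"
    obtain z where "E u z" "z \<noteq> v" using another uv(1) by blast
    then show False using not_on[of u z v] uv \<open>c u = c v\<close> by auto
  qed
  \<comment> \<open>Two segments from \<open>c s\<close> with a further common point have the same
    direction, so the nearer of \<open>c a\<close> and \<open>c b\<close> lies on the other segment,
    which \<open>not_on\<close> excludes.\<close>
  have shared: "p = c s" if sa: "E s a" and sb: "E s b" and ab: "a \<noteq> b"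
    and p: "p \<in> closed_segment (c s) (c a)" "p \<in> closed_segment (c s) (c b)" for s a b p
  proof (rule ccontr)
    assume ne: "p \<noteq> c s"
    obtain k where k: "0 \<le> k" "k \<le> 1" "p = (1 - k) *\<^sub>R c s + k *\<^sub>R c a"
      using p(1) unfolding closed_segment_def by auto
    obtain l where l: "0 \<le> l" "l \<le> 1" "p = (1 - l) *\<^sub>R c s + l *\<^sub>R c b"
      using p(2) unfolding closed_segment_def by auto
    have pos: "k > 0" "l > 0" using k l ne by (auto simp: order_le_less)
    have eq: "k *\<^sub>R (c a - c s) = l *\<^sub>R (c b - c s)"
      using k(3) l(3) by (simp add: algebra_simps)
    have seg: "c s + t *\<^sub>R (q - c s) \<in> closed_segment (c s) q" if "0 \<le> t" "t \<le> 1" for t q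
      unfolding closed_segment_def using that by (auto simp: algebra_simps intro!: exI[of _ t])
    show False
    proof (cases "k \<le> l")
      case True
      have "c b - c s = (k / l) *\<^sub>R (c a - c s)"
        using arg_cong[OF eq, of "\<lambda>w. (1 / l) *\<^sub>R w"] pos by (simp add: field_simps)
      then have "c b = c s + (k / l) *\<^sub>R (c a - c s)" by (simp add: algebra_simps)
      then have "c b \<in> closed_segment (c s) (c a)"
        using seg[of "k / l" "c a"] True pos by simp
      then show False using not_on[OF sa, of b] sb ab by (auto simp: E)
    next
      case False
      have "c a - c s = (l / k) *\<^sub>R (c b - c s)"
        using arg_cong[OF eq, of "\<lambda>w. (1 / k) *\<^sub>R w"] pos by (simp add: field_simps)
      then have "c a = c s + (l / k) *\<^sub>R (c b - c s)" by (simp add: algebra_simps)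
      then have "c a \<in> closed_segment (c s) (c b)"
        using seg[of "l / k" "c b"] False pos by simp
      then show False using not_on[OF sb, of a] sa ab by (auto simp: E)
    qed
  qed
  \<comment> \<open>A shear gives the centres distinct first coordinates.\<close>
  define bad where "bad = (\<lambda>(u, v). - (c u $ 1 - c v $ 1) / (c u $ 2 - c v $ 2)) ` (W \<times> W)"
  have "finite bad" using W by (simp add: bad_def)
  then obtain m where m: "m \<notin> bad"
    using ex_new_if_finite[OF infinite_UNIV_char_0] by blast
  define x where "x v = c v $ 1 + m * c v $ 2" for v
  define y where "y v = c v $ 2" for v
  have inj_x: "inj_on x W"
  proof (rule inj_onI, rule ccontr)
    fix u v assume uv: "u \<in> W" "v \<in> W" "x u = x v" "u \<noteq> v"
    have eq: "m * (c u $ 2 - c v $ 2) = - (c u $ 1 - c v $ 1)"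
      using uv(3) by (simp add: x_def algebra_simps)
    \<comment> \<open>Centres with equal second coordinates are treated separately, because their
      quotient in \<open>bad\<close> is a division by zero and carries no information.\<close>
    have "c u $ 2 \<noteq> c v $ 2"
    proof
      assume "c u $ 2 = c v $ 2"
      then have "c u = c v" using eq by (simp add: vec_eq_iff forall_2)
      then show False using c_inj uv by blast
    qed
    then have "m = - (c u $ 1 - c v $ 1) / (c u $ 2 - c v $ 2)"
      using eq by (simp add: field_simps)
    then show False using m uv by (force simp: bad_def)
  qed
  \<comment> \<open>Points of the sheared drawing are pulled back to the segments between centres;
    since the shear is invertible, equal abscissa and height mean the same point of the
    plane.\<close>
  have point: "\<exists>p\<in>closed_segment (c a) (c b). p $ 2 = height x y a b t \<and> p $ 1 + m * p $ 2 = t"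
    if "x a < x b" "x a \<le> t" "t \<le> x b" for a b t
  proof -
    define k where "k = (t - x a) / (x b - x a)"
    define p where "p = (1 - k) *\<^sub>R c a + k *\<^sub>R c b"
    have "0 \<le> k" "k \<le> 1" using that by (auto simp: k_def field_simps)
    then have "p \<in> closed_segment (c a) (c b)" unfolding closed_segment_def p_def by auto
    moreover have "p $ 2 = y a + k * (y b - y a)" by (simp add: p_def y_def algebra_simps)
    then have "p $ 2 = height x y a b t" by (simp add: height_def k_def)
    moreover have "p $ 1 + m * p $ 2 = x a + k * (x b - x a)"
      by (simp add: p_def x_def algebra_simps)
    then have "p $ 1 + m * p $ 2 = t" using that by (simp add: k_def)
    ultimately show ?thesis by blast
  qed
  interpret plane_drawing W E x y
  proof
    fix a b u v t
    assume ab: "E a b" and uv: "E u v" and ne: "{a, b} \<noteq> {u, v}"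
      and t: "x a \<le> t" "t \<le> x b" "x u \<le> t" "t \<le> x v" "height x y a b t = height x y u v t"
    have lt: "x a < x b" "x u < x v"
      using t ab uv inj_x by (auto simp: E inj_on_def order_le_less)
    obtain p where p: "p \<in> closed_segment (c a) (c b)" "p $ 2 = height x y a b t" "p $ 1 + m * p $ 2 = t"
      using point[OF lt(1) t(1,2)] by blast
    obtain q where q: "q \<in> closed_segment (c u) (c v)" "q $ 2 = height x y u v t" "q $ 1 + m * q $ 2 = t"
      using point[OF lt(2) t(3,4)] by blast
    have "p = q"
      using p q t(5) by (simp add: vec_eq_iff forall_2)
    then have pq: "p \<in> closed_segment (c u) (c v)" using q by simp
    have xp: "x s = t" if "p = c s" for s using p(3) that by (simp add: x_def)
    consider "{a, b} \<inter> {u, v} = {}" | "a = u" "b \<noteq> v" | "b = v" "a \<noteq> u" | "a = v" "b \<noteq> u" | "b = u" "a \<noteq> v"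
      using ne by auto
    then show "\<exists>s\<in>{a, b} \<inter> {u, v}. x s = t"
    proof cases
      case 1
      then show ?thesis using disjoint[OF ab uv _ p(1) pq] by blast
    next
      case 2
      then show ?thesis using shared[OF ab _ 2(2) p(1), of ] uv pq xp by blast
    next
      case 3
      then have "p = c b"
        using shared[OF E_sym[OF ab] _ 3(2), of p] E_sym[OF uv] p(1) pq by (simp add: closed_segment_commute)
      then show ?thesis using 3 xp by auto
    next
      case 4
      then have "p = c a"
        using shared[OF ab _ 4(2), of p] E_sym[OF uv] p(1) pq by (simp add: closed_segment_commute)
      then show ?thesis using 4 xp by auto
    next
      case 5
      then have "p = c b"
        using shared[OF E_sym[OF ab] _ 5(2), of p] uv p(1) pq by (simp add: closed_segment_commute)
      then show ?thesis using 5 xp by auto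
    qed
  next
    show "finite W" "inj_on x W" by (rule W inj_x)+
  qed (auto simp: E E_sym dist_commute add.commute)
  show False
  proof (rule notE[OF neg])
    show "\<exists>v\<in>W. card {z. E v z} \<le> 3"
      by (rule exists_degree_le_3[OF W(2)]) (rule triangle_free)
  qed
qed

text \<open>Greedy colouring: the hypotheses pass to subsets of \<open>W\<close>, so a vertex with
  at most three neighbours can be removed and coloured last.\<close>

lemma disks_4_colouring:
  fixes c :: "'a \<Rightarrow> real ^ 2" and r :: "'a \<Rightarrow> real"
  assumes "finite W"
    and "\<And>u v. u \<in> W \<Longrightarrow> v \<in> W \<Longrightarrow> u \<noteq> v \<Longrightarrow> E u v \<longleftrightarrow> dist (c u) (c v) \<le> r u + r v"
    and "\<And>v. \<not> E v v"
    and "\<And>u v w. u \<in> W \<Longrightarrow> v \<in> W \<Longrightarrow> w \<in> W \<Longrightarrow> E u v \<Longrightarrow> E v w \<Longrightarrow> \<not> E w u"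
  shows "\<exists>col::'a \<Rightarrow> nat. (\<forall>v\<in>W. col v < 4) \<and> (\<forall>u\<in>W. \<forall>v\<in>W. E u v \<longrightarrow> col u \<noteq> col v)"
  using assms
proof (induction "card W" arbitrary: W)
  case 0
  then have "W = {}" by (metis card_0_eq)
  show ?case unfolding \<open>W = {}\<close> by simp
next
  case (Suc n)
  note disks = Suc.prems(2) and irrefl = Suc.prems(3) and tri = Suc.prems(4)
  \<comment> \<open>Adjacency is tied to distances only inside \<open>W\<close>, hence the
    restriction.\<close>
  define F where "F u v \<longleftrightarrow> u \<in> W \<and> v \<in> W \<and> E u v" for u v
  have sym: "F v u" if "F u v" for u v
  proof -
    have uv: "u \<in> W" "v \<in> W" "E u v" "u \<noteq> v" using that irrefl by (auto simp: F_def)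
    then have "dist (c u) (c v) \<le> r u + r v" using disks[of u v] by simp
    then have "dist (c v) (c u) \<le> r v + r u" by (simp only: dist_commute add.commute)
    then show ?thesis using disks[of v u] uv by (simp add: F_def)
  qed
  have "\<exists>v\<in>W. card {z. F v z} \<le> 3"
  proof (rule disks_degree_le_3)
    show "W \<noteq> {}" using Suc.hyps(2) by auto
    show "F u v \<longleftrightarrow> u \<in> W \<and> v \<in> W \<and> u \<noteq> v \<and> dist (c u) (c v) \<le> r u + r v" for u v
    proof (cases "u \<in> W \<and> v \<in> W \<and> u \<noteq> v")
      case True
      then show ?thesis using disks[of u v] unfolding F_def by simp
    next
      case False
      then show ?thesis using irrefl[of u] unfolding F_def by auto
    qed
    show "\<not> F w u" if "F u v" "F v w" for u v w
      using tri[of u v w] that by (simp add: F_def)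
  qed (rule Suc.prems)
  then obtain v where v: "v \<in> W" "card {z. F v z} \<le> 3" by blast
  have "\<exists>col::'a \<Rightarrow> nat. (\<forall>v\<in>W - {v}. col v < 4) \<and> (\<forall>u\<in>W - {v}. \<forall>w\<in>W - {v}. E u w \<longrightarrow> col u \<noteq> col w)"
  proof (rule Suc.hyps(1))
    show "n = card (W - {v})" using Suc.hyps(2) v(1) by simp
    show "E a b \<longleftrightarrow> dist (c a) (c b) \<le> r a + r b" if "a \<in> W - {v}" "b \<in> W - {v}" "a \<noteq> b" for a b
      using that by (intro disks) auto
    show "\<not> E d a" if "a \<in> W - {v}" "b \<in> W - {v}" "d \<in> W - {v}" "E a b" "E b d" for a b d
      using that tri[of a b d] by blast
  qed (use Suc.prems(1) irrefl in simp_all)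
  then obtain col :: "'a \<Rightarrow> nat" where col: "\<And>u. u \<in> W - {v} \<Longrightarrow> col u < 4"
    "\<And>u w. u \<in> W - {v} \<Longrightarrow> w \<in> W - {v} \<Longrightarrow> E u w \<Longrightarrow> col u \<noteq> col w"
    by blast
  have finF: "finite {z. F v z}" by (rule finite_subset[OF _ Suc.prems(1)]) (auto simp: F_def)
  have "\<not> {..<4} \<subseteq> col ` {z. F v z}"
  proof
    assume "{..<4} \<subseteq> col ` {z. F v z}"
    then have "card {..<4::nat} \<le> card {z. F v z}" using finF by (meson card_image_le card_mono finite_imageI le_trans)
    then show False using v(2) by simp
  qed
  then obtain j where j: "j < 4" "j \<notin> col ` {z. F v z}" by auto
  have "(col(v := j)) u \<noteq> (col(v := j)) w" if uw: "u \<in> W" "w \<in> W" "E u w" for u w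
  proof -
    have "u \<noteq> w" using irrefl uw by auto
    moreover have "F u w" "F w u" using uw sym by (auto simp: F_def)
    ultimately show ?thesis
      using j(2) col(2)[of u w] uw by (auto simp: image_iff)
  qed
  moreover have "(col(v := j)) u < 4" if "u \<in> W" for u using j col(1) that by auto
  ultimately show ?case by blast
qed

section \<open>From disks to covers: removing triangles, and the conclusion\<close>

lemma cball_Int_cball_nonempty_iff:
  fixes p q :: "'a::real_normed_vector"
  assumes "0 < s" "0 < t"
  shows "cball p s \<inter> cball q t \<noteq> {} \<longleftrightarrow> dist p q \<le> s + t"
proof
  assume "cball p s \<inter> cball q t \<noteq> {}"
  then obtain z where "dist p z \<le> s" "dist q z \<le> t" by auto
  then show "dist p q \<le> s + t" using dist_triangle[of p q z] by (simp add: dist_commute)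
next
  assume d: "dist p q \<le> s + t"
  \<comment> \<open>The common point divides the segment between the centres in the ratio of the
    radii.\<close>
  define k where "k = s / (s + t)"
  define z where "z = p + k *\<^sub>R (q - p)"
  have k: "0 \<le> k" "k \<le> 1" "1 - k = t / (s + t)" using assms by (auto simp: k_def field_simps)
  have "dist p z = k * dist p q" using k by (simp add: z_def dist_norm norm_minus_commute)
  also have "\<dots> \<le> k * (s + t)" using k d by (intro mult_left_mono)
  also have "\<dots> = s" using assms by (simp add: k_def)
  finally have 1: "dist p z \<le> s" .
  have "q - z = (1 - k) *\<^sub>R (q - p)" by (simp add: z_def algebra_simps)
  then have "dist q z = (1 - k) * dist p q"
    using k(2) by (simp add: dist_norm norm_minus_commute)
  also have "\<dots> \<le> (1 - k) * (s + t)" using k d by (intro mult_left_mono) auto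
  also have "\<dots> = t" using assms k(3) by simp
  finally show "cball p s \<inter> cball q t \<noteq> {}" using 1 by auto
qed

text \<open>Ranging over vertex subsets of a fixed \<open>G\<close> keeps disks and cliques
  unchanged during the induction. After removal of a triangle \<open>T\<close>, every edge meeting
  \<open>T\<close> is covered by \<open>T\<close> itself.\<close>

lemma disk_graph_vertex_cover_le_packing:
  assumes G: "disk_graph G" and W: "W \<subseteq> pverts G"
  shows "\<exists>C s. C \<subseteq> W \<and> (\<forall>u\<in>W. \<forall>v\<in>W. (u, v) \<in> parcs G \<longrightarrow> u \<in> C \<or> v \<in> C) \<and>
    packs G W s \<and> real (card C) \<le> 3 / 2 * s"
  using W
proof (induction "card W" arbitrary: W rule: less_induct)
  case less
  have pg: "pair_graph G" using G by (simp add: disk_graph_def)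
  interpret pair_graph G by (rule pg)
  have finW: "finite W" using less.prems pair_finite_verts finite_subset by metis
  show ?case
  proof (cases "\<exists>u\<in>W. \<exists>v\<in>W. \<exists>w\<in>W. (u, v) \<in> parcs G \<and> (v, w) \<in> parcs G \<and> (w, u) \<in> parcs G")
    case True
    then obtain u v w where uvw: "u \<in> W" "v \<in> W" "w \<in> W"
      "(u, v) \<in> parcs G" "(v, w) \<in> parcs G" "(w, u) \<in> parcs G" by blast
    define T where "T = {u, v, w}"
    have T: "T \<in> cliques G"
      using uvw arcs_symmetric less.prems by (auto simp: T_def cliques_def)
    have "u \<noteq> v" "v \<noteq> w" "w \<noteq> u" using uvw pair_no_loops by fastforce+
    then have cT: "card T = 3" by (simp add: T_def)
    have TW: "T \<subseteq> W" using uvw by (auto simp: T_def)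
    have "card (W - T) < card W"
      using finW uvw by (intro psubset_card_mono) (auto simp: T_def)
    from less.hyps[OF this] less.prems obtain C s where C: "C \<subseteq> W - T"
      "\<forall>u\<in>W - T. \<forall>v\<in>W - T. (u, v) \<in> parcs G \<longrightarrow> u \<in> C \<or> v \<in> C"
      "packs G (W - T) s" "real (card C) \<le> 3 / 2 * s"
      by (metis Diff_subset subset_trans)
    have pT: "packs G T 2" using packs_clique[OF _ T] cT by simp
    have "packs G (T \<union> (W - T)) (2 + s)"
      by (rule packs_Un[OF _ pT C(3)]) auto
    then have "packs G W (2 + s)" using TW by (simp add: Un_absorb1)
    moreover have "real (card (T \<union> C)) \<le> 3 / 2 * (2 + s)"
    proof -
      have "real (card (T \<union> C)) \<le> 3 + real (card C)"
        using card_Un_le[of T C] cT by linarith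
      then show ?thesis using C(4) by simp
    qed
    moreover have "\<forall>u\<in>W. \<forall>v\<in>W. (u, v) \<in> parcs G \<longrightarrow> u \<in> T \<union> C \<or> v \<in> T \<union> C"
      using C(2) by blast
    moreover have "T \<union> C \<subseteq> W" using C(1) TW by blast
    ultimately show ?thesis by blast
  next
    case False
    obtain c :: "'a \<Rightarrow> real ^ 2" and r :: "'a \<Rightarrow> real" where cr: "\<forall>v\<in>pverts G. 0 < r v"
      "\<forall>u\<in>pverts G. \<forall>v\<in>pverts G. u \<noteq> v \<longrightarrow>
         ((u, v) \<in> parcs G \<longleftrightarrow> cball (c u) (r u) \<inter> cball (c v) (r v) \<noteq> {})"
      using G unfolding disk_graph_def by (elim conjE exE) (rule that)
    have "\<exists>col::'a \<Rightarrow> nat. (\<forall>v\<in>W. col v < 4) \<and> (\<forall>u\<in>W. \<forall>v\<in>W. (u, v) \<in> parcs G \<longrightarrow> col u \<noteq> col v)"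
    proof (rule disks_4_colouring[OF finW])
      show "(u, v) \<in> parcs G \<longleftrightarrow> dist (c u) (c v) \<le> r u + r v" if "u \<in> W" "v \<in> W" "u \<noteq> v" for u v
      proof -
        have "u \<in> pverts G" "v \<in> pverts G" using that less.prems by auto
        then show ?thesis
          using cr that(3) cball_Int_cball_nonempty_iff[of "r u" "r v" "c u" "c v"] by simp
      qed
      show "(v, v) \<notin> parcs G" for v using pair_no_loops by fastforce
    qed (use False in blast)
    then show ?thesis using vertex_cover_le_packing_if_4_colourable[OF pg less.prems] by metis
  qed
qed

text \<open>The product form also covers edgeless graphs, for which \<open>FCP G\<close> is
  0.\<close>

theorem theorem4:
  fixes G :: "'a pair_pre_digraph"
  assumes "disk_graph G"
  shows "capacity G \<le> 3 / 2 * FCP G"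
proof -
  have pg: "pair_graph G" using assms by (simp add: disk_graph_def)
  interpret pair_graph G by (rule pg)
  obtain C s where C: "C \<subseteq> pverts G" "\<forall>u\<in>pverts G. \<forall>v\<in>pverts G. (u, v) \<in> parcs G \<longrightarrow> u \<in> C \<or> v \<in> C"
    "packs G (pverts G) s" "real (card C) \<le> 3 / 2 * s"
    using disk_graph_vertex_cover_le_packing[OF assms subset_refl] by blast
  have "capacity G \<le> real (card C)"
  proof (rule capacity_le_vertex_cover[OF pg C(1)])
    fix u v assume "(u, v) \<in> parcs G"
    then show "u \<in> C \<or> v \<in> C"
      using C(2) arc_fst_in_verts[of "(u, v)"] arc_snd_in_verts[of "(u, v)"] by auto
  qed
  also have "\<dots> \<le> 3 / 2 * s" by (rule C(4))
  also have "\<dots> \<le> 3 / 2 * FCP G" using packs_le_FCP[OF _ C(3)] by simp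
  finally show ?thesis .
qed

end
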